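(* Let $k$ be a field of characteristic $p>0$. Suppose that $p$ is odd and $d$ is even with $p>d$. For very general choices of a homogeneous polynomial $f\in k[x,y,z]$ of degree $d$ and any $q=p^e$ (with $e\ge1$), with $R=k[x,y,z]/(f)$ and $\mathfrak m$ its homogeneous maximal ideal, the Castelnuovo–Mumford regularity is given by $$\operatorname{reg}(R/\mathfrak m^{[q]})=\frac32 q+\frac12 d-\frac52 .$$
   Context: $\mathfrak m^{[q]}=(x^q,y^q,z^q)R$. The regularity is the Castelnuovo–Mumford regularity of $R/\mathfrak m^{[q]}$ as a graded module over the polynomial ring $k[x,y,z]$. A statement holds for a ''very general'' $f$ of degree $d$ if there is a countable collection of Zariski open subsets of the affine space of coefficients of degree-$d$ forms in $k[x,y,z]$ whose intersection is nonempty, such that the statement holds for every $f$ whose coefficients lie in that intersection. Throughout, $f$ is a nonzero homogeneous polynomial in $(x,y,z)^2$. *)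

theory Defs
  imports
    "HOL-Library.Poly_Mapping"
    "HOL-Library.Product_Plus"
    "HOL-Library.Extended_Real"
    "HOL-Library.Countable_Set"
    "HOL-Algebra.Algebraic_Closure_Type"
begin

section \<open>The graded polynomial ring in three variables\<close>

text \<open>The polynomial ring \<open>k[x,y,z]\<close> is the monoid algebra of \<open>\<nat>\<^sup>3\<close>: a polynomial is its finitely
  supported family of coefficients, indexed by exponent vectors.\<close>

type_synonym 'k poly3 = "(nat \<times> nat \<times> nat) \<Rightarrow>\<^sub>0 'k"

definition poly3_ring :: "'k::field poly3 ring" where
  "poly3_ring = ring_of_type_algebra"

definition var_x :: "'k::field poly3" where
  "var_x = Poly_Mapping.single (1, 0, 0) 1"

definition var_y :: "'k::field poly3" where
  "var_y = Poly_Mapping.single (0, 1, 0) 1"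

definition var_z :: "'k::field poly3" where
  "var_z = Poly_Mapping.single (0, 0, 1) 1"

fun exponent_degree :: "nat \<times> nat \<times> nat \<Rightarrow> nat" where
  "exponent_degree (a, b, c) = a + b + c"

text \<open>For negative \<open>j\<close> this is \<open>{0}\<close>.\<close>

definition homogeneous_part :: "int \<Rightarrow> 'k::field poly3 set" where
  "homogeneous_part j = {s. \<forall>\<alpha>\<in>Poly_Mapping.keys s. int (exponent_degree \<alpha>) = j}"

definition forms :: "nat \<Rightarrow> 'k::field poly3 set" where
  "forms d = homogeneous_part (int d)"

section \<open>Castelnuovo--Mumford regularity\<close>

text \<open>A graded \<open>k[x,y,z]\<close>-module is given by a module \<open>M\<close> together with the family \<open>G\<close> of its graded
  components. The residue field \<open>k\<close> is resolved by the Koszul complex of \<open>x, y, z\<close>, so that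
  \<open>Tor\<^sub>i(M,k)\<close> is the homology of the complex with terms \<open>M, M(-1)\<^sup>3, M(-2)\<^sup>3, M(-3)\<close> in
  homological degrees \<open>0, 1, 2, 3\<close>. An \<open>i\<close>-chain is the list of its coordinates with respect to the basis
  \<open>e\<^sub>x, e\<^sub>y, e\<^sub>z\<close> for \<open>i = 1\<close>, the basis \<open>e\<^sub>y\<and>e\<^sub>z, e\<^sub>z\<and>e\<^sub>x, e\<^sub>x\<and>e\<^sub>y\<close> for \<open>i = 2\<close>, and
  \<open>e\<^sub>x\<and>e\<^sub>y\<and>e\<^sub>z\<close> for \<open>i = 3\<close>; the basis elements have degree \<open>i\<close>.\<close>

definition koszul_chains :: "(int \<Rightarrow> 'm set) \<Rightarrow> nat \<Rightarrow> int \<Rightarrow> 'm list set" where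
  "koszul_chains G i j = {c. length c = 3 choose i \<and> set c \<subseteq> G (j - int i)}"

text \<open>The differential from \<open>i\<close>-chains to \<open>(i-1)\<close>-chains. The list \<open>[\<zero>]\<close> for \<open>i = 4\<close> is the zero
  chain in homological degree \<open>3\<close>; all other chain groups not listed are zero, with \<open>[]\<close> as only element.\<close>

definition koszul_differential ::
    "('k::field poly3, 'm) module \<Rightarrow> nat \<Rightarrow> 'm list \<Rightarrow> 'm list" where
  "koszul_differential M i c =
    (let mult_x = (\<lambda>m. var_x \<odot>\<^bsub>M\<^esub> m);
         mult_y = (\<lambda>m. var_y \<odot>\<^bsub>M\<^esub> m);
         mult_z = (\<lambda>m. var_z \<odot>\<^bsub>M\<^esub> m) in
     if i = 1 then [mult_x (c ! 0) \<oplus>\<^bsub>M\<^esub> mult_y (c ! 1) \<oplus>\<^bsub>M\<^esub> mult_z (c ! 2)]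
     else if i = 2 then
       [mult_z (c ! 1) \<ominus>\<^bsub>M\<^esub> mult_y (c ! 2),
        mult_x (c ! 2) \<ominus>\<^bsub>M\<^esub> mult_z (c ! 0),
        mult_y (c ! 0) \<ominus>\<^bsub>M\<^esub> mult_x (c ! 1)]
     else if i = 3 then [mult_x (c ! 0), mult_y (c ! 0), mult_z (c ! 0)]
     else if i = 4 then [\<zero>\<^bsub>M\<^esub>]
     else [])"

definition koszul_cycles ::
    "('k::field poly3, 'm) module \<Rightarrow> (int \<Rightarrow> 'm set) \<Rightarrow> nat \<Rightarrow> int \<Rightarrow> 'm list set" where
  "koszul_cycles M G i j =
    {c \<in> koszul_chains G i j. set (koszul_differential M i c) \<subseteq> {\<zero>\<^bsub>M\<^esub>}}"

definition koszul_boundaries ::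
    "('k::field poly3, 'm) module \<Rightarrow> (int \<Rightarrow> 'm set) \<Rightarrow> nat \<Rightarrow> int \<Rightarrow> 'm list set" where
  "koszul_boundaries M G i j = koszul_differential M (Suc i) ` koszul_chains G (Suc i) j"

text \<open>\<open>Tor\<^sub>i(M,k)\<^sub>j \<noteq> 0\<close>, i.e. the graded Betti number \<open>\<beta>\<^sub>i\<^sub>j(M)\<close> does not vanish.\<close>

definition tor_nonzero ::
    "('k::field poly3, 'm) module \<Rightarrow> (int \<Rightarrow> 'm set) \<Rightarrow> nat \<Rightarrow> int \<Rightarrow> bool" where
  "tor_nonzero M G i j \<longleftrightarrow> koszul_cycles M G i j \<noteq> koszul_boundaries M G i j"

text \<open>\<open>reg M = sup {j - i | Tor\<^sub>i(M,k)\<^sub>j \<noteq> 0}\<close>; extended reals are used since \<open>reg 0 = -\<infinity>\<close>.\<close>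

definition regularity :: "('k::field poly3, 'm) module \<Rightarrow> (int \<Rightarrow> 'm set) \<Rightarrow> ereal" where
  "regularity M G = Sup {ereal (real_of_int (j - int i)) | i j. tor_nonzero M G i j}"

section \<open>Frobenius powers of the maximal ideal of a hypersurface ring\<close>

definition hypersurface_ring :: "'k::field poly3 \<Rightarrow> 'k poly3 set ring" where
  "hypersurface_ring f = poly3_ring Quot (PIdl\<^bsub>poly3_ring\<^esub> f)"

definition hypersurface_class :: "'k::field poly3 \<Rightarrow> 'k poly3 \<Rightarrow> 'k poly3 set" where
  "hypersurface_class f s = (PIdl\<^bsub>poly3_ring\<^esub> f) +>\<^bsub>poly3_ring\<^esub> s"

definition frobenius_power :: "'k::field poly3 \<Rightarrow> nat \<Rightarrow> 'k poly3 set set" where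
  "frobenius_power f q = Idl\<^bsub>hypersurface_ring f\<^esub>
     {hypersurface_class f (var_x ^ q), hypersurface_class f (var_y ^ q),
      hypersurface_class f (var_z ^ q)}"

definition quotient_class :: "'k::field poly3 \<Rightarrow> nat \<Rightarrow> 'k poly3 \<Rightarrow> 'k poly3 set set" where
  "quotient_class f q s =
     frobenius_power f q +>\<^bsub>hypersurface_ring f\<^esub> hypersurface_class f s"

text \<open>\<open>R/\<mm>\<^sup>[\<^sup>q\<^sup>]\<close> as a \<open>k[x,y,z]\<close>-module, and its grading by the images of homogeneous polynomials.\<close>

definition frobenius_quotient ::
    "'k::field poly3 \<Rightarrow> nat \<Rightarrow> ('k poly3, 'k poly3 set set) module" where
  "frobenius_quotient f q =
    (let Q = hypersurface_ring f Quot frobenius_power f q in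
     \<lparr>carrier = carrier Q, monoid.mult = monoid.mult Q, one = one Q, ring.zero = ring.zero Q, add = add Q,
      module.smult = (\<lambda>s c. quotient_class f q s \<otimes>\<^bsub>Q\<^esub> c)\<rparr>)"

definition frobenius_quotient_grading ::
    "'k::field poly3 \<Rightarrow> nat \<Rightarrow> int \<Rightarrow> 'k poly3 set set set" where
  "frobenius_quotient_grading f q j = quotient_class f q ` homogeneous_part j"

section \<open>Very general forms\<close>

text \<open>A polynomial function on the space of coefficient vectors: its variables are indexed by the
  exponent vectors \<open>\<alpha>\<close>, the variable \<open>\<alpha>\<close> standing for the coefficient at \<open>\<alpha>\<close>.\<close>

definition eval_at_coeffs ::
    "((nat \<times> nat \<times> nat \<Rightarrow>\<^sub>0 nat) \<Rightarrow>\<^sub>0 'k) \<Rightarrow> 'k::field poly3 \<Rightarrow> 'k" where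
  "eval_at_coeffs P f =
    (\<Sum>m\<in>Poly_Mapping.keys P. Poly_Mapping.lookup P m *
      (\<Prod>\<alpha>\<in>Poly_Mapping.keys m. Poly_Mapping.lookup f \<alpha> ^ Poly_Mapping.lookup m \<alpha>))"

text \<open>Zariski open subsets of the affine space of forms of degree \<open>d\<close>, identified with their
  coefficient vectors. Coefficients outside degree \<open>d\<close> are zero, hence the variables for them are harmless.\<close>

definition zariski_open :: "nat \<Rightarrow> 'k::field poly3 set \<Rightarrow> bool" where
  "zariski_open d U \<longleftrightarrow> (\<exists>T. U = {f \<in> forms d. \<exists>P\<in>T. eval_at_coeffs P f \<noteq> 0})"

definition holds_for_very_general_form :: "nat \<Rightarrow> ('k::field poly3 \<Rightarrow> bool) \<Rightarrow> bool" where
  "holds_for_very_general_form d Prop \<longleftrightarrow>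
    (\<exists>\<U>. countable \<U> \<and> (\<forall>U\<in>\<U>. zariski_open d U) \<and>
         forms d \<inter> \<Inter>\<U> \<noteq> {} \<and> (\<forall>f \<in> forms d \<inter> \<Inter>\<U>. Prop f))"

end

theory Submission
  imports Defs "HOL-Computational_Algebra.Polynomial" "Jordan_Normal_Form.Determinant"
begin

text \<open>Put \<open>d = 2m\<close> and \<open>A = k[x,y,z]/(x\<^sup>q,y\<^sup>q,z\<^sup>q)\<close>, a Gorenstein algebra with socle degree \<open>3q - 3\<close>, and
  let \<open>e = (3q - 3)/2 - m\<close>. Multiplication by \<open>f\<close> from \<open>A\<^sub>e\<close> to \<open>A\<^bsub>e+2m\<^esub>\<close> is given by a square matrix.
  If its determinant does not vanish, then \<open>A/fA = R/\<mm>\<^sup>[\<^sup>q\<^sup>]\<close> is zero in all degrees \<open>\<ge> e + 2m\<close>,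
  while it is nonzero in degree \<open>e + 2m - 1\<close> since \<open>dim A\<^bsub>e-1\<^esub> < dim A\<^bsub>e+2m-1\<^esub>\<close>; so its regularity, which is
  its top degree, is \<open>e + 2m - 1\<close>. For every \<open>q\<close> this is a Zariski open condition on \<open>f\<close>, and one form satisfies all
  of them: \<open>f = (xy + z\<^sup>2)\<^sup>m\<close>. The span of the monomials \<open>x\<^sup>a y\<^sup>b z\<^sup>c\<close> with fixed \<open>a - b\<close> is stable under
  this \<open>f\<close>, and with \<open>t = xy/z\<^sup>2\<close> the claim becomes that a product \<open>(1 + t)\<^sup>m C(t)\<close> cannot be supported on
  certain \<open>m\<close> exponents. These are pairwise incongruent modulo \<open>p\<close> because \<open>p > 2m\<close>, and a nonzero polynomial with
  at most \<open>m\<close> such exponents is not divisible by \<open>(1 + t)\<^sup>m\<close>.\<close>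

section \<open>The Frobenius quotient as a quotient of the polynomial ring\<close>

lemma poly3_ring_simps [simp]:
  "carrier poly3_ring = UNIV" "x \<otimes>\<^bsub>poly3_ring\<^esub> y = x * y" "x \<oplus>\<^bsub>poly3_ring\<^esub> y = x + y"
  "\<zero>\<^bsub>poly3_ring\<^esub> = 0" "\<one>\<^bsub>poly3_ring\<^esub> = 1"
  by (simp_all add: poly3_ring_def ring_of_type_algebra_def)

lemma cring_poly3_ring: "cring (poly3_ring :: 'k::field poly3 ring)"
  unfolding poly3_ring_def by rule

lemma poly3_ring_minus [simp]: "x \<ominus>\<^bsub>poly3_ring\<^esub> y = x - (y :: 'k::field poly3)"
proof -
  interpret cring "poly3_ring :: 'k poly3 ring" by (rule cring_poly3_ring)
  have "\<ominus>\<^bsub>poly3_ring\<^esub> y = - y"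
    using minus_equality[of "- y" y] by simp
  then show ?thesis by (simp add: a_minus_def)
qed

text \<open>The ideal \<open>(f, x^q, y^q, z^q)\<close> of \<open>k[x,y,z]\<close>, the preimage of
  the Frobenius power. Explicit combinations turn statements about cosets of cosets into polynomial
  identities.\<close>

definition frobenius_ideal :: "'k::field poly3 \<Rightarrow> nat \<Rightarrow> 'k poly3 set" where
  "frobenius_ideal f q = {f * a + var_x ^ q * b + var_y ^ q * c + var_z ^ q * d | a b c d. True}"

lemma frobenius_idealI: "s = f * a + var_x ^ q * b + var_y ^ q * c + var_z ^ q * d \<Longrightarrow> s \<in> frobenius_ideal f q"
  by (auto simp: frobenius_ideal_def)

lemma frobenius_idealE:
  assumes "s \<in> frobenius_ideal f q"
  obtains a b c d where "s = f * a + var_x ^ q * b + var_y ^ q * c + var_z ^ q * d"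
  using assms by (auto simp: frobenius_ideal_def)

lemma frobenius_ideal_add:
  assumes "s \<in> frobenius_ideal f q" "t \<in> frobenius_ideal f q"
  shows "s + t \<in> frobenius_ideal f q"
proof -
  obtain a b c d where s: "s = f * a + var_x ^ q * b + var_y ^ q * c + var_z ^ q * d"
    using assms(1) by (rule frobenius_idealE)
  obtain a' b' c' d' where t: "t = f * a' + var_x ^ q * b' + var_y ^ q * c' + var_z ^ q * d'"
    using assms(2) by (rule frobenius_idealE)
  show ?thesis
    by (rule frobenius_idealI[where a = "a + a'" and b = "b + b'" and c = "c + c'" and d = "d + d'"])
       (simp add: s t algebra_simps)
qed

lemma frobenius_ideal_mult:
  assumes "s \<in> frobenius_ideal f q"
  shows "r * s \<in> frobenius_ideal f q"
proof -
  obtain a b c d where s: "s = f * a + var_x ^ q * b + var_y ^ q * c + var_z ^ q * d"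
    using assms(1) by (rule frobenius_idealE)
  show ?thesis
    by (rule frobenius_idealI[where a = "r * a" and b = "r * b" and c = "r * c" and d = "r * d"])
       (simp add: s algebra_simps)
qed

lemma frobenius_ideal_zero: "0 \<in> frobenius_ideal f q"
  by (rule frobenius_idealI[where a = 0 and b = 0 and c = 0 and d = 0]) simp

lemma frobenius_ideal_sum:
  "(\<And>i. i \<in> S \<Longrightarrow> g i \<in> frobenius_ideal f q) \<Longrightarrow> sum g S \<in> frobenius_ideal f q"
  by (induction S rule: infinite_finite_induct) (auto intro: frobenius_ideal_zero frobenius_ideal_add)

lemma ideal_frobenius_ideal: "ideal (frobenius_ideal f q) poly3_ring"
proof -
  interpret cring "poly3_ring :: 'a poly3 ring" by (rule cring_poly3_ring)
  have uminus: "\<ominus>\<^bsub>poly3_ring\<^esub> x \<in> frobenius_ideal f q" if "x \<in> frobenius_ideal f q" for x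
    using frobenius_ideal_mult[OF that, of "-1"] minus_equality[of "- x" x] by simp
  show ?thesis
  proof (rule idealI)
    show "subgroup (frobenius_ideal f q) (add_monoid poly3_ring)"
      using uminus
      by (intro add.subgroupI) (auto intro: frobenius_ideal_add frobenius_ideal_zero simp flip: a_inv_def)
  qed (use frobenius_ideal_mult ring_axioms in \<open>auto simp: mult.commute\<close>)
qed

context
  fixes f :: "'k::field poly3" and q :: nat
begin

interpretation P: cring "poly3_ring :: 'k poly3 ring" by (rule cring_poly3_ring)

interpretation F: ideal "PIdl\<^bsub>poly3_ring\<^esub> f" poly3_ring by (rule P.cgenideal_ideal) simp

interpretation H: cring "hypersurface_ring f"
  unfolding hypersurface_ring_def by (rule F.quotient_is_cring) (rule P.is_cring)

interpretation hc: ring_hom_ring poly3_ring "hypersurface_ring f" "hypersurface_class f"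
  using F.rcos_ring_hom_ring unfolding hypersurface_ring_def hypersurface_class_def .

interpretation FP: ideal "frobenius_power f q" "hypersurface_ring f"
  unfolding frobenius_power_def
  by (rule H.genideal_ideal) auto

interpretation Q: cring "hypersurface_ring f Quot frobenius_power f q"
  by (rule FP.quotient_is_cring) (rule H.is_cring)

interpretation qc: ring_hom_ring poly3_ring "hypersurface_ring f Quot frobenius_power f q" "quotient_class f q"
proof (rule ring_hom_ringI2)
  show "quotient_class f q \<in> Ring.ring_hom poly3_ring (hypersurface_ring f Quot frobenius_power f q)"
    using ring_hom_trans[OF hc.homh FP.rcos_ring_hom]
    by (simp add: quotient_class_def[abs_def] o_def)
qed unfold_locales

lemma PIdl_subset_frobenius_ideal: "PIdl\<^bsub>poly3_ring\<^esub> f \<subseteq> frobenius_ideal f q"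
  unfolding cgenideal_def
proof safe
  fix a :: "'k poly3"
  show "a \<otimes>\<^bsub>poly3_ring\<^esub> f \<in> frobenius_ideal f q"
    by (rule frobenius_idealI[where a = a and b = 0 and c = 0 and d = 0]) simp
qed

text \<open>The quotient map carries ideals to ideals, so minimality of the generated ideal gives
  one inclusion. For the other, the class of \<open>f\<close> vanishes and the classes of the three
  powers are generators.\<close>

lemma frobenius_power_eq: "frobenius_power f q = hypersurface_class f ` frobenius_ideal f q"
proof
  have "ideal (hypersurface_class f ` frobenius_ideal f q) (hypersurface_ring f)"
    unfolding hypersurface_class_def hypersurface_ring_def
    by (rule P.ring_ideal_imp_quot_ideal[OF F.is_ideal ideal_frobenius_ideal])
  moreover have "var_x ^ q \<in> frobenius_ideal f q"
    by (rule frobenius_idealI[where a = 0 and b = 1 and c = 0 and d = 0]) simp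
  moreover have "var_y ^ q \<in> frobenius_ideal f q"
    by (rule frobenius_idealI[where a = 0 and b = 0 and c = 1 and d = 0]) simp
  moreover have "var_z ^ q \<in> frobenius_ideal f q"
    by (rule frobenius_idealI[where a = 0 and b = 0 and c = 0 and d = 1]) simp
  ultimately show "frobenius_power f q \<subseteq> hypersurface_class f ` frobenius_ideal f q"
    unfolding frobenius_power_def by (intro H.genideal_minimal) auto
next
  have gen: "hypersurface_class f (var_x ^ q) \<in> frobenius_power f q"
    "hypersurface_class f (var_y ^ q) \<in> frobenius_power f q"
    "hypersurface_class f (var_z ^ q) \<in> frobenius_power f q"
    unfolding frobenius_power_def by (rule subsetD[OF H.genideal_self]; auto)+
  have mult: "hypersurface_class f (r * s) \<in> frobenius_power f q"
    if "hypersurface_class f r \<in> frobenius_power f q" for r s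
    using FP.I_r_closed[OF that, of "hypersurface_class f s"] hc.hom_mult[of r s] by simp
  have add: "hypersurface_class f (r + s) \<in> frobenius_power f q"
    if "hypersurface_class f r \<in> frobenius_power f q" "hypersurface_class f s \<in> frobenius_power f q" for r s
    using FP.a_closed[OF that] hc.hom_add[of r s] by simp
  have "f \<in> PIdl\<^bsub>poly3_ring\<^esub> f" by (rule P.cgenideal_self) simp
  then have "hypersurface_class f f = hypersurface_class f 0"
    unfolding hypersurface_class_def using P.a_rcos_zero[OF F.is_ideal] F.zero_closed by simp
  then have "hypersurface_class f f \<in> frobenius_power f q"
    using hc.hom_zero FP.zero_closed by simp
  then show "hypersurface_class f ` frobenius_ideal f q \<subseteq> frobenius_power f q"
    by (auto elim!: frobenius_idealE intro!: add mult gen)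
qed

text \<open>Representatives of one class modulo \<open>f\<close> differ by an element of
  \<open>(f)\<close>, which \<open>frobenius_ideal f q\<close> contains; so the iterated quotient is
  the quotient by this one ideal.\<close>

lemma quotient_class_eq_zero_iff:
  "quotient_class f q s = \<zero>\<^bsub>frobenius_quotient f q\<^esub> \<longleftrightarrow> s \<in> frobenius_ideal f q"
proof -
  have "\<zero>\<^bsub>frobenius_quotient f q\<^esub> = frobenius_power f q"
    by (simp add: frobenius_quotient_def FactRing_def)
  then have "quotient_class f q s = \<zero>\<^bsub>frobenius_quotient f q\<^esub> \<longleftrightarrow> hypersurface_class f s \<in> frobenius_power f q"
    unfolding quotient_class_def
    using FP.rcos_const_imp_mem[of "hypersurface_class f s"] H.a_rcos_zero[OF FP.is_ideal] hc.hom_closed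
    by auto
  also have "\<dots> \<longleftrightarrow> s \<in> frobenius_ideal f q"
  proof
    assume "hypersurface_class f s \<in> frobenius_power f q"
    then obtain t where t: "t \<in> frobenius_ideal f q" "hypersurface_class f s = hypersurface_class f t"
      unfolding frobenius_power_eq by auto
    then have "s - t \<in> frobenius_ideal f q"
      using P.quotient_eq_iff_same_a_r_cos[OF F.is_ideal, of s t] PIdl_subset_frobenius_ideal
      by (auto simp: hypersurface_class_def)
    from frobenius_ideal_add[OF this t(1)] show "s \<in> frobenius_ideal f q" by simp
  qed (auto simp: frobenius_power_eq)
  finally show ?thesis .
qed

lemma quotient_class_add:
  "quotient_class f q s \<oplus>\<^bsub>frobenius_quotient f q\<^esub> quotient_class f q t = quotient_class f q (s + t)"
  using qc.hom_add[of s t] by (simp add: frobenius_quotient_def Let_def)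

lemma quotient_class_diff:
  "quotient_class f q s \<ominus>\<^bsub>frobenius_quotient f q\<^esub> quotient_class f q t = quotient_class f q (s - t)"
proof -
  have "quotient_class f q s \<ominus>\<^bsub>frobenius_quotient f q\<^esub> quotient_class f q t =
    quotient_class f q s \<ominus>\<^bsub>hypersurface_ring f Quot frobenius_power f q\<^esub> quotient_class f q t"
    by (simp add: frobenius_quotient_def Let_def a_minus_def a_inv_def m_inv_def)
  also have "\<dots> = quotient_class f q (s \<ominus>\<^bsub>poly3_ring\<^esub> t)"
    using qc.hom_add[of s "\<ominus>\<^bsub>poly3_ring\<^esub> t"] qc.hom_a_inv[of t] by (simp add: a_minus_def)
  finally show ?thesis by simp
qed

lemma quotient_class_smult:
  "r \<odot>\<^bsub>frobenius_quotient f q\<^esub> quotient_class f q s = quotient_class f q (r * s)"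
  using qc.hom_mult[of r s] by (simp add: frobenius_quotient_def Let_def)

end

section \<open>Regularity and top degree\<close>

text \<open>The component of top degree lies in the socle, which is the third Koszul homology.\<close>

lemma regularity_eq_top_degree:
  fixes M :: "('k::field poly3, 'm) module"
  assumes zero: "\<And>j. \<zero>\<^bsub>M\<^esub> \<in> G j"
    and add: "\<And>j m n. m \<in> G j \<Longrightarrow> n \<in> G j \<Longrightarrow> m \<oplus>\<^bsub>M\<^esub> n \<in> G j"
    and diff: "\<And>j m n. m \<in> G j \<Longrightarrow> n \<in> G j \<Longrightarrow> m \<ominus>\<^bsub>M\<^esub> n \<in> G j"
    and smult: "\<And>j m v. m \<in> G j \<Longrightarrow> v \<in> {var_x, var_y, var_z} \<Longrightarrow> v \<odot>\<^bsub>M\<^esub> m \<in> G (j + 1)"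
    and vanish: "\<And>j. j > N \<Longrightarrow> G j = {\<zero>\<^bsub>M\<^esub>}"
    and w: "w \<in> G N" "w \<noteq> \<zero>\<^bsub>M\<^esub>"
  shows "regularity M G = ereal (real_of_int N)"
proof -
  have smult': "v \<odot>\<^bsub>M\<^esub> m \<in> G (j - int i)" if "m \<in> G (j - (1 + int i))" "v \<in> {var_x, var_y, var_z}" for i j m v
    using smult[OF that] by simp
  \<comment> \<open>The internal degree \<open>j\<close> is preserved: a variable raises the degree
    by one, while the basis elements drop from degree \<open>i + 1\<close> to
    \<open>i\<close>.\<close>
  have complex: "koszul_differential M (Suc i) c \<in> koszul_chains G i j"
    if c: "c \<in> koszul_chains G (Suc i) j" for i j c
  proof -
    have len: "length c = 3 choose Suc i" and mem: "\<And>m. m \<in> set c \<Longrightarrow> m \<in> G (j - (1 + int i))"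
      using c by (auto simp: koszul_chains_def)
    consider "i = 0" | "i = 1" | "i = 2" | "i = 3" | "i \<ge> 4" by linarith
    then show ?thesis
    proof cases
      case 1
      then obtain m0 m1 m2 where "c = [m0, m1, m2]"
        using len by (auto simp: length_Suc_conv numeral_3_eq_3)
      then show ?thesis
        using 1 smult'[of _ j 0] mem by (auto simp: koszul_differential_def koszul_chains_def Let_def intro!: add)
    next
      case 2
      then have "length c = Suc (Suc (Suc 0))" using len by (simp add: choose_two flip: numeral_2_eq_2)
      then obtain m0 m1 m2 where "c = [m0, m1, m2]"
        by (auto simp: length_Suc_conv)
      then show ?thesis
        using 2 smult'[of _ j 1] mem by (auto simp: koszul_differential_def koszul_chains_def Let_def intro!: diff)
    next
      case 3
      then have "length c = Suc 0" using len by simp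
      then obtain m0 where "c = [m0]"
        by (auto simp: length_Suc_conv)
      then show ?thesis
        using 3 smult'[of _ j 2] mem by (auto simp: koszul_differential_def koszul_chains_def Let_def choose_two)
    next
      case 4
      then show ?thesis
        using zero by (auto simp: koszul_differential_def koszul_chains_def Let_def)
    next
      case 5
      then show ?thesis
        by (auto simp: koszul_differential_def koszul_chains_def Let_def)
    qed
  qed
  have lists: "length c = n \<and> set c \<subseteq> {\<zero>\<^bsub>M\<^esub>} \<longleftrightarrow> c = replicate n \<zero>\<^bsub>M\<^esub>" for c n
    using replicate_eqI[of c n "\<zero>\<^bsub>M\<^esub>"] by auto
  have upper: "j - int i \<le> N" if "tor_nonzero M G i j" for i j
  proof (rule ccontr)
    assume "\<not> j - int i \<le> N"
    then have N: "j - int i > N" by simp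
    have chains: "koszul_chains G i j = {replicate (3 choose i) \<zero>\<^bsub>M\<^esub>}"
      using lists unfolding koszul_chains_def vanish[OF N] by blast
    \<comment> \<open>The chain of zeros exists one step up in any case, so the boundaries form a
      nonempty subset of a singleton.\<close>
    have "replicate (3 choose Suc i) \<zero>\<^bsub>M\<^esub> \<in> koszul_chains G (Suc i) j"
      using zero unfolding koszul_chains_def by (simp add: set_replicate_conv_if del: binomial_Suc_Suc)
    then have "koszul_boundaries M G i j \<noteq> {}"
      by (auto simp: koszul_boundaries_def)
    moreover have "koszul_boundaries M G i j \<subseteq> koszul_chains G i j"
      using complex by (auto simp: koszul_boundaries_def)
    ultimately have "koszul_boundaries M G i j = koszul_chains G i j"
      unfolding chains by blast
    moreover have "koszul_cycles M G i j = koszul_chains G i j"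
    proof (cases i)
      case 0
      then show ?thesis by (auto simp: koszul_cycles_def koszul_differential_def Let_def)
    next
      case (Suc i')
      \<comment> \<open>The differential lands in the component of degree \<open>j - i + 1\<close>,
        still above \<open>N\<close>; so every chain is a cycle.\<close>
      then have "G (j - int i') = {\<zero>\<^bsub>M\<^esub>}" using N vanish by simp
      then show ?thesis
        using complex[of _ i' j] Suc unfolding koszul_cycles_def by (auto simp: koszul_chains_def)
    qed
    ultimately show False using that by (simp add: tor_nonzero_def)
  qed
  have "tor_nonzero M G 3 (N + 3)"
  proof -
    have "set (koszul_differential M 3 [w]) \<subseteq> G (N + 1)"
      using smult w by (auto simp: koszul_differential_def Let_def)
    then have "[w] \<in> koszul_cycles M G 3 (N + 3)"
      using vanish[of "N + 1"] w by (auto simp: koszul_cycles_def koszul_chains_def)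
    moreover have "[w] \<notin> koszul_boundaries M G 3 (N + 3)"
      using w by (auto simp: koszul_boundaries_def koszul_differential_def Let_def)
    ultimately show ?thesis by (auto simp: tor_nonzero_def)
  qed
  then have mem: "ereal (real_of_int N) \<in> {ereal (real_of_int (j - int i)) | i j. tor_nonzero M G i j}"
    by (auto intro!: exI[of _ 3] exI[of _ "N + 3"])
  show ?thesis
    unfolding regularity_def
    by (rule antisym[OF Sup_least Sup_upper[OF mem]]) (use upper in \<open>auto simp del: of_int_diff\<close>)
qed

section \<open>Coefficients of products\<close>

lemma poly_mapping_eq_sum_single: "(\<Sum>\<beta>\<in>Poly_Mapping.keys s. Poly_Mapping.single \<beta> (Poly_Mapping.lookup s \<beta>)) = s"
  by (rule poly_mapping_eqI)
     (simp add: lookup_sum lookup_single when_def in_keys_iff)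

lemma lookup_single_mult:
  fixes f :: "'k::field poly3"
  shows "Poly_Mapping.lookup (Poly_Mapping.single (a, b, c) v * f) (i, j, l) =
    (if a \<le> i \<and> b \<le> j \<and> c \<le> l then v * Poly_Mapping.lookup f (i - a, j - b, l - c) else 0)"
proof -
  have "((i, j, l) = (a, b, c) + \<gamma>) \<longleftrightarrow> a \<le> i \<and> b \<le> j \<and> c \<le> l \<and> \<gamma> = (i - a, j - b, l - c)" for \<gamma>
    by (cases \<gamma>) (auto simp: plus_prod_def)
  then show ?thesis
    by (simp add: lookup_mult lookup_single when_mult when_when flip: when_when) (auto simp: when_def)
qed

lemma lookup_mult_eq_sum:
  fixes f g :: "'k::field poly3"
  shows "Poly_Mapping.lookup (g * f) (i, j, l) =
    (\<Sum>(a, b, c)\<in>Poly_Mapping.keys g. if a \<le> i \<and> b \<le> j \<and> c \<le> l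
       then Poly_Mapping.lookup g (a, b, c) * Poly_Mapping.lookup f (i - a, j - b, l - c) else 0)"
proof -
  have "Poly_Mapping.lookup (g * f) (i, j, l) = Poly_Mapping.lookup ((\<Sum>\<beta>\<in>Poly_Mapping.keys g. Poly_Mapping.single \<beta> (Poly_Mapping.lookup g \<beta>)) * f) (i, j, l)"
    by (simp only: poly_mapping_eq_sum_single)
  also have "\<dots> = (\<Sum>\<beta>\<in>Poly_Mapping.keys g. Poly_Mapping.lookup (Poly_Mapping.single \<beta> (Poly_Mapping.lookup g \<beta>) * f) (i, j, l))"
    by (simp only: sum_distrib_right lookup_sum)
  also have "\<dots> = (\<Sum>(a, b, c)\<in>Poly_Mapping.keys g. if a \<le> i \<and> b \<le> j \<and> c \<le> l
       then Poly_Mapping.lookup g (a, b, c) * Poly_Mapping.lookup f (i - a, j - b, l - c) else 0)"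
    by (intro sum.cong) (auto simp: lookup_single_mult)
  finally show ?thesis .
qed

section \<open>Reduced monomials as a basis modulo \<open>x^q\<close>, \<open>y^q\<close>,
  \<open>z^q\<close>\<close>

lemma var_power:
  "(var_x :: 'k::field poly3) ^ n = Poly_Mapping.single (n, 0, 0) 1"
  "(var_y :: 'k::field poly3) ^ n = Poly_Mapping.single (0, n, 0) 1"
  "(var_z :: 'k::field poly3) ^ n = Poly_Mapping.single (0, 0, n) 1"
  unfolding var_x_def var_y_def var_z_def
  by (induction n; simp add: mult_single plus_prod_def flip: zero_prod_def)+

definition reduced_exponents :: "nat \<Rightarrow> (nat \<times> nat \<times> nat) set" where
  "reduced_exponents q = {..<q} \<times> {..<q} \<times> {..<q}"

lemma lookup_mod_frobenius_ideal:
  fixes f :: "'k::field poly3"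
  assumes "\<alpha> \<in> reduced_exponents q"
  shows "Poly_Mapping.lookup (f * a + var_x ^ q * b + var_y ^ q * c + var_z ^ q * d) \<alpha> = Poly_Mapping.lookup (f * a) \<alpha>"
  using assms by (cases \<alpha>) (auto simp: reduced_exponents_def var_power lookup_add lookup_single_mult)

text \<open>Every nonreduced monomial is divisible by \<open>x^q\<close>, \<open>y^q\<close> or
  \<open>z^q\<close>.\<close>

lemma frobenius_idealI_lookup:
  assumes "\<And>\<alpha>. \<alpha> \<in> reduced_exponents q \<Longrightarrow> Poly_Mapping.lookup s \<alpha> = 0"
  shows "s \<in> frobenius_ideal f q"
proof -
  have mono: "Poly_Mapping.single \<beta> v \<in> frobenius_ideal f q" if "\<beta> \<notin> reduced_exponents q" for \<beta> v
  proof -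
    obtain a b c where \<beta>: "\<beta> = (a, b, c)" by (cases \<beta>)
    with that consider "q \<le> a" | "q \<le> b" | "q \<le> c" by (auto simp: reduced_exponents_def not_less)
    then show ?thesis
    proof cases
      case 1
      then show ?thesis
        by (intro frobenius_idealI[where a = 0 and b = "Poly_Mapping.single (a - q, b, c) v" and c = 0 and d = 0])
           (simp add: \<beta> var_power mult_single plus_prod_def)
    next
      case 2
      then show ?thesis
        by (intro frobenius_idealI[where a = 0 and c = "Poly_Mapping.single (a, b - q, c) v" and b = 0 and d = 0])
           (simp add: \<beta> var_power mult_single plus_prod_def)
    next
      case 3
      then show ?thesis
        by (intro frobenius_idealI[where a = 0 and d = "Poly_Mapping.single (a, b, c - q) v" and b = 0 and c = 0])
           (simp add: \<beta> var_power mult_single plus_prod_def)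
    qed
  qed
  have "(\<Sum>\<beta>\<in>Poly_Mapping.keys s. Poly_Mapping.single \<beta> (Poly_Mapping.lookup s \<beta>)) \<in> frobenius_ideal f q"
    using assms by (intro frobenius_ideal_sum mono) (auto simp: in_keys_iff)
  then show ?thesis by (simp only: poly_mapping_eq_sum_single)
qed

section \<open>Sparse polynomials divisible by a power of a linear form\<close>

text \<open>Induction on the set of admissible exponents: one exponent is traded for one factor
  \<open>1 + t\<close>. Since the exponents are distinct in \<open>k\<close>, no other monomial is
  lost on the way.\<close>

lemma sparse_poly_eq_0:
  fixes P :: "'k::field poly"
  assumes "finite S" "card S \<le> m" "\<And>n. coeff P n \<noteq> 0 \<Longrightarrow> n \<in> S"
    and "inj_on (of_nat :: nat \<Rightarrow> 'k) S" and "[:1, 1:] ^ m dvd P"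
  shows "P = 0"
  using assms
proof (induction S arbitrary: m P rule: finite_induct)
  case empty
  then show ?case by (auto simp: poly_eq_iff)
next
  case (insert n S)
  then obtain m' where m: "m = Suc m'" by (cases m) auto
  obtain R where R: "P = [:1, 1:] ^ m * R" using insert.prems(4) by (rule dvdE)
  \<comment> \<open>the Euler operator minus \<open>n\<close> removes the monomial of degree \<open>n\<close> and lowers the multiplicity of the root by at most one\<close>
  define P' where "P' = pCons 0 (pderiv P) - smult (of_nat n) P"
  have coeff: "coeff P' k = (of_nat k - of_nat n) * coeff P k" for k
    by (cases k) (auto simp: P'_def coeff_pderiv algebra_simps)
  have "P' = 0"
  proof (rule insert.IH)
    show "card S \<le> m'" using insert m by simp
    show "inj_on (of_nat :: nat \<Rightarrow> 'k) S" using insert.prems(3) by (rule inj_on_subset) auto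
    show "k \<in> S" if "coeff P' k \<noteq> 0" for k using that insert.prems(2)[of k] by (auto simp: coeff)
    have "pderiv P = [:1, 1:] ^ m' * (smult (of_nat m) R + [:1, 1:] * pderiv R)"
      unfolding R m pderiv_mult pderiv_power_Suc by (simp add: pderiv_pCons algebra_simps)
    then have "[:1, 1:] ^ m' dvd pderiv P" by simp
    then have "[:1, 1:] ^ m' dvd [:0, 1:] * pderiv P" by (rule dvd_mult)
    moreover have "[:1, 1:] ^ m' dvd P"
      unfolding R m by (intro dvd_mult2 le_imp_power_dvd) simp
    ultimately show "[:1, 1:] ^ m' dvd P'"
      unfolding P'_def by (intro dvd_diff dvd_smult) auto
  qed
  have zero: "coeff P k = 0" if "k \<noteq> n" for k
  proof (rule ccontr)
    assume nz: "coeff P k \<noteq> 0"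
    then have "k \<in> insert n S" by (rule insert.prems(2))
    then have "(of_nat k :: 'k) \<noteq> of_nat n"
      using inj_onD[OF insert.prems(3), of k n] that by blast
    then show False using coeff[of k] nz \<open>P' = 0\<close> by simp
  qed
  then have "P = monom (coeff P n) n" by (auto simp: poly_eq_iff)
  \<comment> \<open>A nonzero monomial does not vanish at -1, but \<open>P\<close> does because
    \<open>m\<close> is positive.\<close>
  then have "poly P (-1) = coeff P n * (-1) ^ n" by (metis poly_monom)
  moreover have "poly P (-1) = 0" by (simp add: R m)
  ultimately have "coeff P n = 0" by simp
  with zero show ?case by (metis leading_coeff_0_iff)
qed

text \<open>The coefficient of \<open>C\<close> at \<open>s\<close> belongs to
  \<open>x^(w+s) y^s z^(r-2s)\<close>, that of \<open>P\<close> to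
  \<open>x^(w+s) y^s z^(r+2m-2s)\<close>. The hypothesis on \<open>C\<close> says that its monomials
  are reduced, the one on \<open>P\<close> that the product vanishes modulo \<open>x^q\<close>,
  \<open>y^q\<close>, \<open>z^q\<close>.\<close>

lemma sparse_one_plus_X_power_mult_eq_0:
  fixes C :: "'k::field poly" and m p q r w :: nat
  defines "P \<equiv> [:1, 1:] ^ m * C"
  assumes char: "CHAR('k) = p" and "p dvd q" "odd q" "2 * m < p"
    and rw: "2 * (r + w + m) + 3 = 3 * q"
    and C: "\<And>s. coeff C s \<noteq> 0 \<Longrightarrow> w + s < q \<and> 2 * s \<le> r \<and> r < q + 2 * s"
    and P: "\<And>s. w + s < q \<Longrightarrow> r + 2 * m < q + 2 * s \<Longrightarrow> coeff P s = 0"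
  shows "C = 0"
proof (rule ccontr)
  assume nz: "C \<noteq> 0"
  have deg: "degree P = m + degree C"
    using nz by (simp add: P_def degree_mult_eq degree_power_eq)
  have degC: "w + degree C < q" "2 * degree C \<le> r" "r < q + 2 * degree C"
    using C[of "degree C"] nz by (auto simp: leading_coeff_0_iff)
  have Pnz: "P \<noteq> 0" using nz by (auto simp: P_def)
  show False
  proof (cases "r + 2 * m < q")
    case True
    \<comment> \<open>In this case no \<open>z\<close>-exponent reaches \<open>q\<close>, so the
      lowest term of \<open>C\<close> survives in the product.\<close>
    define k where "k = (LEAST k. coeff C k \<noteq> 0)"
    have k: "coeff C k \<noteq> 0" unfolding k_def
      by (rule LeastI[of _ "degree C"]) (simp add: nz)
    have low: "coeff C i = 0" if "i < k" for i
      using not_less_Least[of i "\<lambda>k. coeff C k \<noteq> 0"] that by (auto simp: k_def)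
    have "coeff P k = (\<Sum>i\<le>k. coeff ([:1, 1:] ^ m) i * coeff C (k - i))"
      by (simp add: P_def coeff_mult)
    also have "\<dots> = coeff ([:1, 1:] ^ m) 0 * coeff C (k - 0)"
      by (subst sum.remove[of _ 0]) (auto intro!: sum.neutral low)
    also have "\<dots> = coeff C k" by (simp add: coeff_0_power)
    finally show False using k C[OF k] P[of k] True by simp
  next
    case False
    show False
    proof (cases "r + 2 * m < 2 * (q - w)")
      case True
      \<comment> \<open>Here even the top term of \<open>P\<close> has \<open>x\<close>-exponent
        below \<open>q\<close>, because \<open>2 * degree C \<le> r\<close>.\<close>
      have "coeff P (m + degree C) \<noteq> 0"
        using Pnz deg by (metis leading_coeff_0_iff)
      moreover have "w + (m + degree C) < q" using True degC by arith
      moreover have "r + 2 * m < q + 2 * (m + degree C)" using degC by simp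
      ultimately show False using P by blast
    next
      case ge: False
      \<comment> \<open>The exponents where \<open>P\<close> may be nonzero: a low block with
        \<open>z\<close>-exponent at least \<open>q\<close> and a high block with
        \<open>x\<close>-exponent at least \<open>q\<close>.\<close>
      define S where "S = {s. 2 * s + q \<le> r + 2 * m} \<union> {s. q \<le> w + s \<and> 2 * s \<le> r + 2 * m}"
      have S_eq: "S = {..(r + 2 * m - q) div 2} \<union> {q - w..(r + 2 * m) div 2}"
        using False by (auto simp: S_def)
      have fin: "finite S" by (simp add: S_eq)
      have "card S \<le> card {..(r + 2 * m - q) div 2} + card {q - w..(r + 2 * m) div 2}"
        unfolding S_eq by (rule card_Un_le)
      also have "\<dots> = m"
      proof -
        \<comment> \<open>As \<open>q\<close> is odd, exactly one of \<open>r + 2m\<close> and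
          \<open>r + 2m - q\<close> is odd; so the two roundings together lose one half, and by
          \<open>rw\<close> the two blocks have \<open>m\<close> elements in total.\<close>
        obtain h where q: "q = 2 * h + 1" using \<open>odd q\<close> by (rule oddE)
        have "(r + 2 * m - q) div 2 + (r + 2 * m) div 2 + 2 = m + (q - w)"
        proof (cases "even (r + 2 * m)")
          case True
          then obtain t where t: "r + 2 * m = 2 * t" by (rule evenE)
          then have "r + 2 * m - q = 2 * (t - h - 1) + 1" "w < q" using False q degC by auto
          then show ?thesis using t q rw by simp
        next
          case odd: False
          then obtain t where t: "r + 2 * m = 2 * t + 1" by (rule oddE)
          then have "r + 2 * m - q = 2 * (t - h)" "w < q" using False q degC by auto
          then show ?thesis using t q rw False by simp
        qed
        moreover have "q - w \<le> (r + 2 * m) div 2" using ge by simp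
        ultimately show ?thesis unfolding card_atMost card_atLeastAtMost by linarith
      qed
      finally have card: "card S \<le> m" .
      have supp: "n \<in> S" if "coeff P n \<noteq> 0" for n
      proof -
        have "n \<le> m + degree C" using that deg le_degree[of P n] by simp
        moreover have "q \<le> w + n \<or> 2 * n + q \<le> r + 2 * m"
          using that P[of n] by linarith
        ultimately show ?thesis using degC by (auto simp: S_def)
      qed
      have inj: "inj_on (of_nat :: nat \<Rightarrow> 'k) S"
      proof (rule linorder_inj_onI)
        fix i j assume ij: "i < j" "i \<in> S" "j \<in> S"
        have "\<not> p dvd j - i"
        proof
          assume dvd: "p dvd j - i"
          then have le: "p \<le> j - i" using ij by (auto dest: dvd_imp_le)
          \<comment> \<open>Elements of one block differ by less than \<open>m\<close>, so a
            difference of at least \<open>p\<close> puts \<open>i\<close> into the low and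
            \<open>j\<close> into the high block.\<close>
          then have "2 * i + q \<le> r + 2 * m" and "q \<le> w + j" "2 * j \<le> r + 2 * m"
            using ij rw False ge \<open>2 * m < p\<close> by (auto simp: S_def)
          then have "2 * (j - i) < q + p" "q < 2 * (j - i) + p"
            using ij rw False ge \<open>2 * m < p\<close> by auto
          moreover have "2 * (j - i) \<noteq> q" using \<open>odd q\<close> by auto
          moreover have "int p dvd \<bar>2 * int (j - i) - int q\<bar>"
            using dvd \<open>p dvd q\<close> by (metis dvd_abs_iff dvd_diff dvd_mult int_dvd_int_iff)
          \<comment> \<open>\<open>2(j - i) - q\<close> is odd, of absolute value less than \<open>p\<close>, and divisible by \<open>p\<close>\<close>
          ultimately show False
            using zdvd_imp_le[of "int p" "\<bar>2 * int (j - i) - int q\<bar>"] by linarith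
        qed
        then have "(of_nat (j - i) :: 'k) \<noteq> 0" using char by (simp add: of_nat_eq_0_iff_char_dvd)
        then show "(of_nat i :: 'k) \<noteq> of_nat j" using ij by (auto simp: of_nat_diff)
      qed auto
      show False
        using sparse_poly_eq_0[of S m P, OF fin card supp inj] Pnz by (auto simp: P_def)
    qed
  qed
qed

section \<open>Powers of a conic\<close>

lemma coeff_sum_monom_atMost: "coeff (\<Sum>s\<le>n. monom (u s) s) t = (if t \<le> n then u t else 0)"
  by (simp add: coeff_sum)

lemma coeff_one_plus_X_power: "coeff ([:1, 1:] ^ m) i = (of_nat (m choose i) :: 'k::field)"
proof (cases "i \<le> m")
  case False
  then show ?thesis by (simp add: coeff_eq_0 degree_power_eq binomial_eq_0)
qed (simp add: coeff_linear_poly_power)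

text \<open>\<open>v\<close> is the coefficient array of an element of degree \<open>e\<close> in
  \<open>A\<close> that \<open>(xy + z^2)^m\<close> annihilates. Each term of this power raises the
  exponents of \<open>x\<close> and \<open>y\<close> equally, so the strands of fixed
  \<open>a - b\<close> can be treated separately.\<close>

lemma conic_power_kernel:
  fixes v :: "nat \<Rightarrow> nat \<Rightarrow> nat \<Rightarrow> 'k::field"
  assumes char: "CHAR('k) = p" "p dvd q" "odd q" "2 * m < p" and e: "2 * (e + m) + 3 = 3 * q"
    and v: "\<And>a b c. v a b c \<noteq> 0 \<Longrightarrow> a < q \<and> b < q \<and> c < q \<and> a + b + c = e"
    and kernel: "\<And>a b c. a < q \<Longrightarrow> b < q \<Longrightarrow> c < q \<Longrightarrow> a + b + c = e + 2 * m \<Longrightarrow>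
      (\<Sum>i\<le>m. if i \<le> a \<and> i \<le> b \<and> 2 * (m - i) \<le> c
        then of_nat (m choose i) * v (a - i) (b - i) (c - 2 * (m - i)) else 0) = 0"
    and "b \<le> a"
  shows "v a b c = 0"
proof (rule ccontr)
  assume nz: "v a b c \<noteq> 0"
  \<comment> \<open>the part of \<open>v\<close> with the same exponent difference \<open>a - b\<close>, as a polynomial in \<open>t = xy/z\<^sup>2\<close>\<close>
  define w r where "w = a - b" and "r = 2 * b + c"
  define C where "C = (\<Sum>s\<le>r div 2. monom (v (w + s) s (r - 2 * s)) s)"
  have coeff_C: "coeff C s = (if 2 * s \<le> r then v (w + s) s (r - 2 * s) else 0)" for s
    by (auto simp: C_def coeff_sum_monom_atMost)
  have rw: "2 * (r + w + m) + 3 = 3 * q"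
    using v[OF nz] \<open>b \<le> a\<close> e by (simp add: w_def r_def)
  have "C = 0"
  proof (rule sparse_one_plus_X_power_mult_eq_0[OF char rw])
    show "w + s < q \<and> 2 * s \<le> r \<and> r < q + 2 * s" if "coeff C s \<noteq> 0" for s
      using that v[of "w + s" s "r - 2 * s"] by (auto simp: coeff_C split: if_splits)
    show "coeff ([:1, 1:] ^ m * C) s = 0" if s: "w + s < q" "r + 2 * m < q + 2 * s" for s
    proof -
      have "coeff ([:1, 1:] ^ m * C) s = (\<Sum>i\<le>s. of_nat (m choose i) * coeff C (s - i))"
        by (simp add: coeff_mult coeff_one_plus_X_power)
      also have "\<dots> = (\<Sum>i\<le>m. if i \<le> s then of_nat (m choose i) * coeff C (s - i) else 0)"
        by (rule sum.mono_neutral_cong) (auto simp: binomial_eq_0)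
      also have "\<dots> = 0"
      proof (cases "2 * s \<le> r + 2 * m")
        case True
        have "(\<Sum>i\<le>m. if i \<le> s then of_nat (m choose i) * coeff C (s - i) else 0) =
          (\<Sum>i\<le>m. if i \<le> w + s \<and> i \<le> s \<and> 2 * (m - i) \<le> r + 2 * m - 2 * s
        then of_nat (m choose i) * v (w + s - i) (s - i) (r + 2 * m - 2 * s - 2 * (m - i)) else 0)"
        proof (intro sum.cong refl)
          fix i assume "i \<in> {..m}"
          then have "2 * (m - i) \<le> r + 2 * m - 2 * s \<longleftrightarrow> 2 * (s - i) \<le> r" if "i \<le> s"
            using True that by auto
          moreover have "r + 2 * m - 2 * s - 2 * (m - i) = r - 2 * (s - i)" if "i \<le> s"
            using True that \<open>i \<in> {..m}\<close> by auto
          ultimately show "(if i \<le> s then of_nat (m choose i) * coeff C (s - i) else 0) =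
            (if i \<le> w + s \<and> i \<le> s \<and> 2 * (m - i) \<le> r + 2 * m - 2 * s
             then of_nat (m choose i) * v (w + s - i) (s - i) (r + 2 * m - 2 * s - 2 * (m - i)) else 0)"
            by (auto simp: coeff_C)
        qed
        also have "\<dots> = 0"
          by (rule kernel) (use s True rw e in auto)
        finally show ?thesis .
      next
        case False
        \<comment> \<open>Here \<open>2 * (s - i) > r\<close> for all \<open>i \<le> m\<close> with
          \<open>i \<le> s\<close>, so every coefficient of \<open>C\<close> in the sum is
          zero.\<close>
        then show ?thesis by (intro sum.neutral) (auto simp: coeff_C)
      qed
      finally show ?thesis .
    qed
  qed
  moreover have "coeff C b = v a b c"
    using \<open>b \<le> a\<close> by (simp add: coeff_C w_def r_def)
  ultimately show False using nz by simp
qed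

text \<open>The binomial expansion of \<open>(xy + z\<^sup>2)\<^sup>m\<close>.\<close>

definition conic_power :: "nat \<Rightarrow> 'k::field poly3" where
  "conic_power m = (\<Sum>i\<le>m. Poly_Mapping.single (i, i, 2 * (m - i)) (of_nat (m choose i)))"

lemma conic_power_forms: "conic_power m \<in> forms (2 * m)"
proof -
  have "Poly_Mapping.keys (conic_power m :: 'a poly3) \<subseteq>
      (\<Union>i\<le>m. Poly_Mapping.keys (Poly_Mapping.single (i, i, 2 * (m - i)) (of_nat (m choose i) :: 'a)))"
    unfolding conic_power_def by (rule keys_sum)
  then show ?thesis
    by (fastforce simp: forms_def homogeneous_part_def split: if_splits)
qed

lemma lookup_conic_power_mult:
  "Poly_Mapping.lookup (conic_power m * g) (a, b, c) =
    (\<Sum>i\<le>m. if i \<le> a \<and> i \<le> b \<and> 2 * (m - i) \<le> c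
      then of_nat (m choose i) * Poly_Mapping.lookup g (a - i, b - i, c - 2 * (m - i)) else 0)"
  by (simp add: conic_power_def sum_distrib_right lookup_sum lookup_single_mult)

section \<open>Injectivity of multiplication by the conic power\<close>

definition reduced_monomials :: "nat \<Rightarrow> nat \<Rightarrow> (nat \<times> nat \<times> nat) set" where
  "reduced_monomials q j = {\<alpha> \<in> reduced_exponents q. exponent_degree \<alpha> = j}"

lemma reduced_monomials_iff:
  "(a, b, c) \<in> reduced_monomials q j \<longleftrightarrow> a < q \<and> b < q \<and> c < q \<and> a + b + c = j"
  by (auto simp: reduced_monomials_def reduced_exponents_def)

lemma finite_reduced_monomials: "finite (reduced_monomials q j)"
  by (simp add: reduced_monomials_def reduced_exponents_def)

text \<open>Swapping \<open>x\<close> and \<open>y\<close> fixes the conic, so the strands with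
  \<open>a \<le> b\<close> reduce to those with \<open>b \<le> a\<close>.\<close>

lemma conic_power_injective:
  fixes g :: "'k::field poly3"
  assumes char: "CHAR('k) = p" "p dvd q" "odd q" "2 * m < p" and e: "2 * (e + m) + 3 = 3 * q"
    and g: "Poly_Mapping.keys g \<subseteq> reduced_monomials q e"
    and kernel: "\<And>\<alpha>. \<alpha> \<in> reduced_monomials q (e + 2 * m) \<Longrightarrow> Poly_Mapping.lookup (conic_power m * g) \<alpha> = 0"
  shows "g = 0"
proof (rule poly_mapping_eqI)
  fix \<alpha> :: "nat \<times> nat \<times> nat"
  obtain a b c where \<alpha>: "\<alpha> = (a, b, c)" by (cases \<alpha>)
  have supp: "a < q \<and> b < q \<and> c < q \<and> a + b + c = e" if "Poly_Mapping.lookup g (a, b, c) \<noteq> 0" for a b c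
    using g that by (simp add: subset_iff in_keys_iff flip: reduced_monomials_iff)
  consider "b \<le> a" | "a \<le> b" by linarith
  then have "Poly_Mapping.lookup g (a, b, c) = 0"
  proof cases
    case 1
    show ?thesis
      by (rule conic_power_kernel[OF char e, where v = "\<lambda>a b c. Poly_Mapping.lookup g (a, b, c)"])
         (use supp 1 kernel in \<open>auto simp: reduced_monomials_iff lookup_conic_power_mult\<close>)
  next
    case 2
    show ?thesis
    proof (rule conic_power_kernel[OF char e, where v = "\<lambda>b a c. Poly_Mapping.lookup g (a, b, c)" and a = b and b = a])
      fix a b c assume *: "a < q" "b < q" "c < q" "a + b + c = e + 2 * m"
      show "(\<Sum>i\<le>m. if i \<le> a \<and> i \<le> b \<and> 2 * (m - i) \<le> c
        then of_nat (m choose i) * Poly_Mapping.lookup g (b - i, a - i, c - 2 * (m - i)) else 0) = 0"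
        using kernel[of "(b, a, c)"] * by (auto simp: reduced_monomials_iff lookup_conic_power_mult conj_ac)
    qed (use supp 2 in fastforce)+
  qed
  then show "Poly_Mapping.lookup g \<alpha> = Poly_Mapping.lookup 0 \<alpha>" by (simp add: \<alpha>)
qed

section \<open>Determinants as polynomial functions of the coefficients\<close>

lemma eval_at_coeffs_superset:
  assumes "finite K" "Poly_Mapping.keys P \<subseteq> K"
  shows "eval_at_coeffs P f = (\<Sum>m\<in>K. Poly_Mapping.lookup P m *
      (\<Prod>\<alpha>\<in>Poly_Mapping.keys m. Poly_Mapping.lookup f \<alpha> ^ Poly_Mapping.lookup m \<alpha>))"
  unfolding eval_at_coeffs_def
  by (rule sum.mono_neutral_left) (use assms in \<open>auto simp: in_keys_iff\<close>)

lemma eval_at_coeffs_add: "eval_at_coeffs (P + Q) f = eval_at_coeffs P f + eval_at_coeffs Q f"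
proof -
  let ?K = "Poly_Mapping.keys P \<union> Poly_Mapping.keys Q"
  have "finite ?K" by simp
  note K = eval_at_coeffs_superset[OF this]
  show ?thesis
    using keys_add[of P Q]
    by (simp add: K[of P] K[of Q] K[of "P + Q"] lookup_add ring_distribs sum.distrib)
qed

lemma eval_at_coeffs_zero [simp]: "eval_at_coeffs 0 f = 0"
  by (simp add: eval_at_coeffs_def)

lemma eval_at_coeffs_sum: "eval_at_coeffs (\<Sum>i\<in>I. P i) f = (\<Sum>i\<in>I. eval_at_coeffs (P i) f)"
  by (induction I rule: infinite_finite_induct) (simp_all add: eval_at_coeffs_add)

text \<open>\<open>E\<close> may repeat values: summing unit exponents collects equal coefficients
  into powers, so any product of coefficients is the value of one monomial.\<close>

lemma eval_at_coeffs_monomial: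
  assumes "finite I"
  shows "eval_at_coeffs (Poly_Mapping.single (\<Sum>i\<in>I. Poly_Mapping.single (E i) 1) v) f =
    v * (\<Prod>i\<in>I. Poly_Mapping.lookup f (E i))"
proof -
  define monom_val where "monom_val = (\<lambda>m. \<Prod>\<alpha>\<in>Poly_Mapping.keys m. Poly_Mapping.lookup f \<alpha> ^ Poly_Mapping.lookup m \<alpha>)"
  have superset: "monom_val m = (\<Prod>\<alpha>\<in>K. Poly_Mapping.lookup f \<alpha> ^ Poly_Mapping.lookup m \<alpha>)"
    if "finite K" "Poly_Mapping.keys m \<subseteq> K" for m :: "nat \<times> nat \<times> nat \<Rightarrow>\<^sub>0 nat" and K
    unfolding monom_val_def
    by (rule prod.mono_neutral_left) (use that in \<open>auto simp: in_keys_iff\<close>)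
  have add: "monom_val (m + m') = monom_val m * monom_val m'" for m m'
  proof -
    let ?K = "Poly_Mapping.keys m \<union> Poly_Mapping.keys m'"
    have "finite ?K" by simp
    note K = superset[OF this]
    show ?thesis
      using keys_add[of m m']
      by (simp add: K[of m] K[of m'] K[of "m + m'"] lookup_add power_add prod.distrib)
  qed
  have "monom_val (\<Sum>i\<in>I. Poly_Mapping.single (E i) 1) = (\<Prod>i\<in>I. Poly_Mapping.lookup f (E i))"
    using assms
  proof (induction I rule: finite_induct)
    case empty
    then show ?case by (simp add: monom_val_def)
  next
    case (insert i I)
    have "monom_val (Poly_Mapping.single (E i) 1) = Poly_Mapping.lookup f (E i)"
      by (simp add: monom_val_def)
    with insert show ?case by (simp add: add)
  qed
  then show ?thesis
    by (simp add: eval_at_coeffs_def monom_val_def)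
qed

text \<open>By the Leibniz formula the determinant is a single polynomial in the coefficients,
  whatever the indexing \<open>E\<close>.\<close>

lemma zariski_open_det_nonzero:
  "zariski_open d {f \<in> forms d. det (mat n n (\<lambda>(i, j). Poly_Mapping.lookup f (E i j))) \<noteq> (0 :: 'k::field)}"
proof -
  define P :: "(nat \<times> nat \<times> nat \<Rightarrow>\<^sub>0 nat) \<Rightarrow>\<^sub>0 'k" where
    "P = (\<Sum>\<pi> | \<pi> permutes {0..<n}. Poly_Mapping.single (\<Sum>i\<in>{0..<n}. Poly_Mapping.single (E i (\<pi> i)) 1) (signof \<pi>))"
  have "eval_at_coeffs P f = det (mat n n (\<lambda>(i, j). Poly_Mapping.lookup f (E i j)))" for f
  proof -
    have "(\<Prod>i\<in>{0..<n}. mat n n (\<lambda>(i, j). Poly_Mapping.lookup f (E i j)) $$ (i, \<pi> i)) =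
      (\<Prod>i\<in>{0..<n}. Poly_Mapping.lookup f (E i (\<pi> i)))" if "\<pi> permutes {0..<n}" for \<pi>
      using permutes_in_image[OF that] by (intro prod.cong) auto
    then show ?thesis
      by (simp add: P_def eval_at_coeffs_sum eval_at_coeffs_monomial[unfolded One_nat_def] det_def'[of _ n])
  qed
  then show ?thesis
    unfolding zariski_open_def by (intro exI[of _ "{P}"]) simp
qed

section \<open>Nonvanishing by counting monomials\<close>

text \<open>Complementing exponents, \<open>a\<close> to \<open>q - 1 - a\<close>, exchanges two
  degrees that add up to the socle degree \<open>3q - 3\<close>.\<close>

lemma card_reduced_monomials_reflect:
  assumes "i + j + 3 = 3 * q"
  shows "card (reduced_monomials q i) = card (reduced_monomials q j)"
proof (rule bij_betw_same_card)
  let ?\<sigma> = "\<lambda>(a, b, c). (q - 1 - a, q - 1 - b, q - 1 - c)"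
  show "bij_betw ?\<sigma> (reduced_monomials q i) (reduced_monomials q j)"
    by (rule bij_betw_byWitness[where f' = ?\<sigma>])
       (use assms in \<open>auto simp: reduced_monomials_iff\<close>)
qed

text \<open>Multiplication by \<open>z\<close> matches all monomials but those with
  \<open>z\<close>-exponent \<open>q - 1\<close> in degree \<open>j\<close> and those free of
  \<open>z\<close> in degree \<open>j + 1\<close>. These are counted by pairs of degree
  \<open>j + 1 - q\<close> and \<open>j + 1\<close>; counts of pairs peak at degree
  \<open>q - 1\<close>, and the bound puts \<open>j + 1\<close> nearer to the peak.\<close>

lemma card_reduced_monomials_less_Suc:
  assumes "2 * j + 5 \<le> 3 * q"
  shows "card (reduced_monomials q j) < card (reduced_monomials q (Suc j))"
proof -
  define pairs where "pairs n = {(a, b). a < q \<and> b < q \<and> a + b = n}" for n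
  have pairs_eq: "pairs n = (\<lambda>a. (a, n - a)) ` {Suc n - q..min n (q - 1)}" if "q > 0" for n
    using that by (auto simp: pairs_def image_iff)
  have card_pairs: "card (pairs n) = Suc (min n (q - 1)) - (Suc n - q)" if "q > 0" for n
    unfolding pairs_eq[OF that] by (subst card_image) (auto simp: inj_on_def)
  have fin: "finite (pairs n)" for n
    by (rule finite_subset[of _ "{..<q} \<times> {..<q}"]) (auto simp: pairs_def)
  have "q > 0" using assms by simp
  let ?S = "(\<lambda>(a, b, c). (a, b, Suc c)) ` {\<alpha> \<in> reduced_monomials q j. Suc (snd (snd \<alpha>)) < q}"
  have S: "reduced_monomials q (Suc j) = ?S \<union> (\<lambda>(a, b). (a, b, 0)) ` pairs (Suc j)"
  proof (intro equalityI subsetI)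
    fix \<alpha> assume \<alpha>: "\<alpha> \<in> reduced_monomials q (Suc j)"
    obtain a b c where abc: "\<alpha> = (a, b, c)" by (cases \<alpha>)
    show "\<alpha> \<in> ?S \<union> (\<lambda>(a, b). (a, b, 0)) ` pairs (Suc j)"
    proof (cases c)
      case 0
      then show ?thesis using \<alpha> abc by (auto simp: reduced_monomials_iff pairs_def)
    next
      case (Suc c')
      then have "(a, b, c') \<in> {\<alpha> \<in> reduced_monomials q j. Suc (snd (snd \<alpha>)) < q}"
        using \<alpha> abc by (auto simp: reduced_monomials_iff)
      then show ?thesis using abc Suc by force
    qed
  qed (auto simp: reduced_monomials_iff pairs_def \<open>q > 0\<close>)
  have T: "reduced_monomials q j = {\<alpha> \<in> reduced_monomials q j. Suc (snd (snd \<alpha>)) < q} \<union>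
      (\<lambda>(a, b). (a, b, q - 1)) ` (if q - 1 \<le> j then pairs (j - (q - 1)) else {})"
    by (force simp: reduced_monomials_iff pairs_def image_iff)
  let ?T = "(if q - 1 \<le> j then pairs (j - (q - 1)) else {})"
  have "card (reduced_monomials q j) \<le> card {\<alpha> \<in> reduced_monomials q j. Suc (snd (snd \<alpha>)) < q} + card ?T"
    by (subst T, rule order_trans[OF card_Un_le], rule add_left_mono, rule card_image_le) (simp add: fin)
  also have "card ?T < card (pairs (Suc j))"
    using assms by (auto simp: card_pairs \<open>q > 0\<close>)
  also have "card {\<alpha> \<in> reduced_monomials q j. Suc (snd (snd \<alpha>)) < q} + card (pairs (Suc j)) =
      card (reduced_monomials q (Suc j))"
  proof -
    have inj3: "inj_on (\<lambda>(a, b, c). (a, b, Suc c)) A" for A :: "(nat \<times> nat \<times> nat) set"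
      by (auto simp: inj_on_def)
    have inj2: "inj_on (\<lambda>(a, b). (a, b, 0 :: nat)) A" for A :: "(nat \<times> nat) set"
      by (auto simp: inj_on_def)
    then show ?thesis
      unfolding S by (subst card_Un_disjoint)
        (auto simp: fin finite_reduced_monomials card_image[OF inj3] card_image[OF inj2])
  qed
  finally show ?thesis by simp
qed

section \<open>Failure of surjectivity by dimension\<close>

text \<open>Padding with zero rows gives a square matrix; each Leibniz product contains an entry of
  the zero row \<open>n'\<close>, so the matrix is singular.\<close>

lemma underdetermined_system:
  fixes A :: "nat \<Rightarrow> nat \<Rightarrow> 'k::field"
  assumes "n' < n"
  obtains v j where "j < n" "v j \<noteq> 0" "\<And>i. i < n' \<Longrightarrow> (\<Sum>j<n. A i j * v j) = 0"
proof -
  define M where "M = mat n n (\<lambda>(i, j). if i < n' then A i j else 0)"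
  have M: "M \<in> carrier_mat n n" by (simp add: M_def)
  have zero: "(\<Prod>i\<in>{0..<n}. M $$ (i, \<pi> i)) = 0" if "\<pi> permutes {0..<n}" for \<pi>
    using assms permutes_in_image[OF that, of n'] by (auto intro!: bexI[of _ n'] simp: M_def)
  have "det M = 0"
    unfolding det_def'[OF M] by (intro sum.neutral ballI) (simp only: mem_Collect_eq zero mult_zero_right)
  then obtain u where u: "u \<in> carrier_vec n" "u \<noteq> 0\<^sub>v n" "M *\<^sub>v u = 0\<^sub>v n"
    using det_0_iff_vec_prod_zero_field[OF M] by blast
  then obtain j where "j < n" "u $ j \<noteq> 0"
    by (metis eq_vecI carrier_vecD index_zero_vec)
  moreover have "(\<Sum>j<n. A i j * u $ j) = 0" if "i < n'" for i
  proof -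
    have "(M *\<^sub>v u) $ i = (\<Sum>j\<in>{0..<n}. A i j * u $ j)"
      using that assms u(1) by (simp add: M_def scalar_prod_def)
    then show ?thesis using u(3) that assms by (simp add: atLeast0LessThan)
  qed
  ultimately show thesis using that by blast
qed

lemma lookup_forms_eq_0: "f \<in> forms d \<Longrightarrow> exponent_degree \<alpha> \<noteq> d \<Longrightarrow> Poly_Mapping.lookup f \<alpha> = 0"
  by (auto simp: forms_def homogeneous_part_def in_keys_iff)

text \<open>The solution \<open>v\<close> is a nonzero linear functional on degree
  \<open>i + d\<close> of \<open>A\<close> that kills all multiples of \<open>f\<close>; a monomial
  on which it is nonzero cannot lie in the ideal.\<close>

lemma exists_monomial_notin_frobenius_ideal:
  fixes f :: "'k::field poly3"
  assumes f: "f \<in> forms d"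
    and card: "card (reduced_monomials q i) < card (reduced_monomials q (i + d))"
  obtains \<alpha> where "\<alpha> \<in> reduced_monomials q (i + d)" "Poly_Mapping.single \<alpha> 1 \<notin> frobenius_ideal f q"
proof -
  let ?n = "card (reduced_monomials q (i + d))" and ?n' = "card (reduced_monomials q i)"
  obtain h where h: "bij_betw h {0..<?n} (reduced_monomials q (i + d))"
    using ex_bij_betw_nat_finite[OF finite_reduced_monomials] by blast
  obtain k where k: "bij_betw k {0..<?n'} (reduced_monomials q i)"
    using ex_bij_betw_nat_finite[OF finite_reduced_monomials] by blast
  define C where "C = (\<lambda>\<beta> \<alpha>. Poly_Mapping.lookup (Poly_Mapping.single \<beta> 1 * f) \<alpha>)"
  obtain v j where j: "j < ?n" "v j \<noteq> 0"
    and v: "\<And>i. i < ?n' \<Longrightarrow> (\<Sum>j<?n. C (k i) (h j) * v j) = 0"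
    using underdetermined_system[OF card, of "\<lambda>i j. C (k i) (h j)"] by blast
  have hj: "h j \<in> reduced_monomials q (i + d)" if "j < ?n" for j
    using bij_betwE[OF h] that by auto
  \<comment> \<open>A divisor of a reduced monomial is reduced, and a nonzero coefficient of
    \<open>f\<close> forces \<open>\<beta>\<close> into degree \<open>i\<close>; all other
    \<open>\<beta>\<close> contribute zeros only.\<close>
  have C_eq_0: "(\<Sum>j<?n. C \<beta> (h j) * v j) = 0" for \<beta>
  proof (cases "\<beta> \<in> reduced_monomials q i")
    case True
    then obtain l where "l < ?n'" "\<beta> = k l"
      using bij_betw_imp_surj_on[OF k] by force
    then show ?thesis using v by simp
  next
    case False
    have "C \<beta> (h l) = 0" if "l < ?n" for l
    proof -
      obtain a b c where \<beta>: "\<beta> = (a, b, c)" by (cases \<beta>)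
      obtain a' b' c' where hl: "h l = (a', b', c')" by (cases "h l")
      show ?thesis
        using False hj[OF that] unfolding C_def \<beta> hl
        by (auto simp: lookup_single_mult reduced_monomials_iff intro!: lookup_forms_eq_0[OF f])
    qed
    then show ?thesis by simp
  qed
  have "Poly_Mapping.single (h j) 1 \<notin> frobenius_ideal f q"
  proof
    assume "Poly_Mapping.single (h j) 1 \<in> frobenius_ideal f q"
    then obtain a b c e where eq: "Poly_Mapping.single (h j) 1 = f * a + var_x ^ q * b + var_y ^ q * c + var_z ^ q * e"
      by (rule frobenius_idealE)
    have "Poly_Mapping.lookup (f * a) (h l) = (if l = j then 1 else 0)" if "l < ?n" for l
    proof -
      have "Poly_Mapping.lookup (f * a) (h l) = Poly_Mapping.lookup (Poly_Mapping.single (h j) 1) (h l)"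
        unfolding eq using hj[OF that] by (subst lookup_mod_frobenius_ideal) (auto simp: reduced_monomials_def)
      also have "\<dots> = (if l = j then 1 else 0)"
        using bij_betw_imp_inj_on[OF h] that j by (auto simp: lookup_single when_def dest: inj_onD)
      finally show ?thesis .
    qed
    then have "(\<Sum>l<?n. Poly_Mapping.lookup (f * a) (h l) * v l) = (\<Sum>l<?n. if l = j then v l else 0)"
      by (intro sum.cong) auto
    then have "v j = (\<Sum>l<?n. Poly_Mapping.lookup (f * a) (h l) * v l)"
      using j by simp
    also have "f * a = (\<Sum>\<beta>\<in>Poly_Mapping.keys a. Poly_Mapping.single 0 (Poly_Mapping.lookup a \<beta>) * (Poly_Mapping.single \<beta> 1 * f))"
      by (simp add: mult_single poly_mapping_eq_sum_single flip: mult.assoc sum_distrib_right)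
    also have "(\<Sum>l<?n. Poly_Mapping.lookup \<dots> (h l) * v l) =
        (\<Sum>l<?n. \<Sum>\<beta>\<in>Poly_Mapping.keys a. Poly_Mapping.lookup a \<beta> * (C \<beta> (h l) * v l))"
    proof (intro sum.cong refl)
      fix l
      have "Poly_Mapping.lookup (Poly_Mapping.single 0 u * g) \<alpha> = u * Poly_Mapping.lookup g \<alpha>"
        for u :: 'k and g and \<alpha> :: "nat \<times> nat \<times> nat"
        using lookup_single_mult[of 0 0 0 u g] by (cases \<alpha>) (simp add: zero_prod_def)
      then show "Poly_Mapping.lookup (\<Sum>\<beta>\<in>Poly_Mapping.keys a. Poly_Mapping.single 0 (Poly_Mapping.lookup a \<beta>) * (Poly_Mapping.single \<beta> 1 * f)) (h l) * v l =
        (\<Sum>\<beta>\<in>Poly_Mapping.keys a. Poly_Mapping.lookup a \<beta> * (C \<beta> (h l) * v l))"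
        by (simp add: lookup_sum sum_distrib_right C_def mult.assoc)
    qed
    also have "\<dots> = 0"
      by (subst sum.swap) (simp add: C_eq_0 flip: sum_distrib_left)
    finally show False using j by simp
  qed
  with hj[OF j(1)] show thesis by (rule that)
qed

section \<open>Bijectivity in the middle degree\<close>

text \<open>On reduced exponents, division of the socle monomial \<open>(xyz)^(q-1)\<close> by the
  given monomial: Gorenstein duality on the monomial basis.\<close>

fun reflected_exponent :: "nat \<Rightarrow> nat \<times> nat \<times> nat \<Rightarrow> nat \<times> nat \<times> nat" where
  "reflected_exponent q (a, b, c) = (q - 1 - a, q - 1 - b, q - 1 - c)"

text \<open>The subtractions below may be truncated; the result then has too large a degree to be an
  exponent of the form \<open>f\<close> in the matrix of multiplication by \<open>f\<close>.\<close>

fun complementary_exponent :: "nat \<Rightarrow> nat \<times> nat \<times> nat \<Rightarrow> nat \<times> nat \<times> nat \<Rightarrow> nat \<times> nat \<times> nat" where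
  "complementary_exponent q (a, b, c) (a', b', c') = (q - 1 - a - a', q - 1 - b - b', q - 1 - c - c')"

text \<open>One arbitrary enumeration, independent of \<open>f\<close>, so that the determinant
  below is one polynomial function of the coefficients of \<open>f\<close>.\<close>

definition enum_reduced_monomials :: "nat \<Rightarrow> nat \<Rightarrow> nat \<Rightarrow> nat \<times> nat \<times> nat" where
  "enum_reduced_monomials q e =
    (SOME h. bij_betw h {0..<card (reduced_monomials q e)} (reduced_monomials q e))"

lemma bij_enum_reduced_monomials:
  "bij_betw (enum_reduced_monomials q e) {0..<card (reduced_monomials q e)} (reduced_monomials q e)"
  unfolding enum_reduced_monomials_def
  using ex_bij_betw_nat_finite[OF finite_reduced_monomials] by (rule someI_ex)

text \<open>The target monomials are enumerated by the reflections of the source monomials.\<close>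

definition multiplication_matrix :: "nat \<Rightarrow> nat \<Rightarrow> 'k::field poly3 \<Rightarrow> 'k mat" where
  "multiplication_matrix q e f =
    mat (card (reduced_monomials q e)) (card (reduced_monomials q e)) (\<lambda>(i, j). Poly_Mapping.lookup f
      (complementary_exponent q (enum_reduced_monomials q e i) (enum_reduced_monomials q e j)))"

context
  fixes q e m :: nat
  assumes e: "2 * (e + m) + 3 = 3 * q"
begin

private abbreviation "n \<equiv> card (reduced_monomials q e)"
private abbreviation "h \<equiv> enum_reduced_monomials q e"

lemma enum_reduced_monomials_mem: "i < n \<Longrightarrow> h i \<in> reduced_monomials q e"
  using bij_betwE[OF bij_enum_reduced_monomials] by auto

lemma enum_reduced_monomials_eq_iff: "i < n \<Longrightarrow> j < n \<Longrightarrow> h i = h j \<longleftrightarrow> i = j"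
  by (simp add: inj_on_eq_iff[OF bij_betw_imp_inj_on[OF bij_enum_reduced_monomials]])

text \<open>By the condition on \<open>e\<close>, the degrees \<open>e\<close> and
  \<open>e + 2m\<close> add up to \<open>3q - 3\<close>, so reflection exchanges them and the matrix
  can be square.\<close>

lemma reduced_monomials_cases:
  assumes "\<alpha> \<in> reduced_monomials q (e + 2 * m)"
  obtains i where "i < n" "\<alpha> = reflected_exponent q (h i)"
proof -
  obtain a b c where \<alpha>: "\<alpha> = (a, b, c)" by (cases \<alpha>)
  have "reflected_exponent q \<alpha> \<in> reduced_monomials q e"
    using assms e unfolding \<alpha> by (auto simp: reduced_monomials_iff)
  then obtain i where "i < n" "reflected_exponent q \<alpha> = h i"
    using bij_betw_imp_surj_on[OF bij_enum_reduced_monomials] by force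
  moreover have "reflected_exponent q (reflected_exponent q \<alpha>) = \<alpha>"
    using assms unfolding \<alpha> by (auto simp: reduced_monomials_iff)
  ultimately show thesis using that by metis
qed

lemma lookup_mult_reflected:
  fixes f g :: "'k::field poly3"
  assumes f: "f \<in> forms (2 * m)" and g: "Poly_Mapping.keys g \<subseteq> reduced_monomials q e" and i: "i < n"
  shows "Poly_Mapping.lookup (f * g) (reflected_exponent q (h i)) =
    (\<Sum>j\<in>{0..<n}. multiplication_matrix q e f $$ (i, j) * Poly_Mapping.lookup g (h j))"
proof -
  obtain a b c where hi: "h i = (a, b, c)" by (cases "h i")
  have abc: "(a, b, c) \<in> reduced_monomials q e" using enum_reduced_monomials_mem[OF i] hi by simp
  have "Poly_Mapping.lookup (f * g) (reflected_exponent q (h i)) =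
    (\<Sum>(a', b', c')\<in>reduced_monomials q e. if a' \<le> q - 1 - a \<and> b' \<le> q - 1 - b \<and> c' \<le> q - 1 - c
       then Poly_Mapping.lookup g (a', b', c') * Poly_Mapping.lookup f (q - 1 - a - a', q - 1 - b - b', q - 1 - c - c') else 0)"
    unfolding hi mult.commute[of f g] reflected_exponent.simps lookup_mult_eq_sum
    by (rule sum.mono_neutral_left) (use g finite_reduced_monomials in \<open>auto simp: in_keys_iff\<close>)
  also have "\<dots> = (\<Sum>\<beta>\<in>reduced_monomials q e. Poly_Mapping.lookup f (complementary_exponent q (h i) \<beta>) * Poly_Mapping.lookup g \<beta>)"
  proof (rule sum.cong[OF refl], clarify)
    fix a' b' c' assume \<beta>: "(a', b', c') \<in> reduced_monomials q e"
    \<comment> \<open>Without truncation the three differences add up to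
      \<open>3q - 3 - 2e = 2m\<close>; truncation pushes the sum above the degree of
      \<open>f\<close>.\<close>
    have "Poly_Mapping.lookup f (complementary_exponent q (a, b, c) (a', b', c')) = 0"
      if "\<not> (a' \<le> q - 1 - a \<and> b' \<le> q - 1 - b \<and> c' \<le> q - 1 - c)"
      by (rule lookup_forms_eq_0[OF f]) (use that abc \<beta> e in \<open>auto simp: reduced_monomials_iff\<close>)
    then show "(if a' \<le> q - 1 - a \<and> b' \<le> q - 1 - b \<and> c' \<le> q - 1 - c
       then Poly_Mapping.lookup g (a', b', c') * Poly_Mapping.lookup f (q - 1 - a - a', q - 1 - b - b', q - 1 - c - c') else 0) =
      Poly_Mapping.lookup f (complementary_exponent q (h i) (a', b', c')) * Poly_Mapping.lookup g (a', b', c')"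
      by (simp add: hi)
  qed
  also have "\<dots> = (\<Sum>j\<in>{0..<n}. Poly_Mapping.lookup f (complementary_exponent q (h i) (h j)) * Poly_Mapping.lookup g (h j))"
    by (rule sum.reindex_bij_betw[OF bij_enum_reduced_monomials, symmetric])
  finally show ?thesis using i by (simp add: multiplication_matrix_def)
qed

lemma lookup_sum_enum:
  assumes "j < n"
  shows "Poly_Mapping.lookup (\<Sum>i\<in>{0..<n}. Poly_Mapping.single (h i) (u i)) (h j) = (u j :: 'k::field)"
proof -
  have "Poly_Mapping.lookup (\<Sum>i\<in>{0..<n}. Poly_Mapping.single (h i) (u i)) (h j) =
      (\<Sum>i\<in>{0..<n}. if i = j then u i else 0)"
    unfolding lookup_sum
    by (rule sum.cong) (use assms in \<open>auto simp: lookup_single when_def enum_reduced_monomials_eq_iff\<close>)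
  then show ?thesis using assms by simp
qed

lemma keys_sum_enum:
  "Poly_Mapping.keys (\<Sum>i\<in>{0..<n}. Poly_Mapping.single (h i) (u i :: 'k::field)) \<subseteq> reduced_monomials q e"
  using enum_reduced_monomials_mem
  by (intro order_trans[OF keys_sum]) (auto split: if_splits)

text \<open>A kernel vector would be a nonzero form of degree \<open>e\<close> with reduced
  monomials, annihilated in \<open>A\<close> by the conic power.\<close>

lemma det_conic_power_nonzero:
  assumes "CHAR('k::field) = p" "p dvd q" "odd q" "2 * m < p"
  shows "det (multiplication_matrix q e (conic_power m :: 'k poly3)) \<noteq> 0"
proof
  let ?M = "multiplication_matrix q e (conic_power m :: 'k poly3)"
  have M: "?M \<in> carrier_mat n n" by (simp add: multiplication_matrix_def)
  assume "det ?M = 0"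
  then obtain u where u: "u \<in> carrier_vec n" "u \<noteq> 0\<^sub>v n" "?M *\<^sub>v u = 0\<^sub>v n"
    using det_0_iff_vec_prod_zero_field[OF M] by blast
  define g where "g = (\<Sum>i\<in>{0..<n}. Poly_Mapping.single (h i) (u $ i))"
  have keys: "Poly_Mapping.keys g \<subseteq> reduced_monomials q e"
    unfolding g_def by (rule keys_sum_enum)
  have "g = 0"
  proof (rule conic_power_injective[OF assms e keys])
    fix \<alpha> assume "\<alpha> \<in> reduced_monomials q (e + 2 * m)"
    then obtain i where i: "i < n" "\<alpha> = reflected_exponent q (h i)" by (rule reduced_monomials_cases)
    have "Poly_Mapping.lookup (conic_power m * g) \<alpha> = (\<Sum>j\<in>{0..<n}. ?M $$ (i, j) * Poly_Mapping.lookup g (h j))"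
      unfolding i(2) by (rule lookup_mult_reflected[OF conic_power_forms keys i(1)])
    also have "\<dots> = (\<Sum>j\<in>{0..<n}. ?M $$ (i, j) * u $ j)"
      by (intro sum.cong refl) (simp add: g_def lookup_sum_enum)
    also have "\<dots> = (?M *\<^sub>v u) $ i"
      using i M u(1) by (simp add: scalar_prod_def)
    finally show "Poly_Mapping.lookup (conic_power m * g) \<alpha> = 0" using u(3) i by simp
  qed
  then have "u $ i = 0" if "i < n" for i
    using lookup_sum_enum[OF that, of "\<lambda>i. u $ i"] by (simp add: g_def)
  then show False using u by auto
qed

text \<open>Cramer's rule: a column of the adjugate gives a form \<open>g\<close> such that
  \<open>f * g\<close> is the determinant times the prescribed monomial modulo \<open>x^q\<close>,
  \<open>y^q\<close>, \<open>z^q\<close>.\<close>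

lemma single_mem_frobenius_ideal:
  fixes f :: "'k::field poly3"
  assumes f: "f \<in> forms (2 * m)" and det: "det (multiplication_matrix q e f) \<noteq> 0"
    and \<alpha>: "\<alpha> \<in> reduced_monomials q (e + 2 * m)"
  shows "Poly_Mapping.single \<alpha> 1 \<in> frobenius_ideal f q"
proof -
  let ?M = "multiplication_matrix q e f"
  have M: "?M \<in> carrier_mat n n" by (simp add: multiplication_matrix_def)
  obtain i where i: "i < n" "\<alpha> = reflected_exponent q (h i)" using \<alpha> by (rule reduced_monomials_cases)
  define g where "g = (\<Sum>j\<in>{0..<n}. Poly_Mapping.single (h j) (adj_mat ?M $$ (j, i)))"
  have keys: "Poly_Mapping.keys g \<subseteq> reduced_monomials q e"
    unfolding g_def by (rule keys_sum_enum)
  have "f * g \<in> frobenius_ideal f q"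
    by (rule frobenius_idealI[where a = g and b = 0 and c = 0 and d = 0]) simp
  moreover have "Poly_Mapping.single \<alpha> (det ?M) - f * g \<in> frobenius_ideal f q"
  proof (rule frobenius_idealI_lookup)
    fix \<beta> assume \<beta>: "\<beta> \<in> reduced_exponents q"
    show "Poly_Mapping.lookup (Poly_Mapping.single \<alpha> (det ?M) - f * g) \<beta> = 0"
    proof (cases "\<beta> \<in> reduced_monomials q (e + 2 * m)")
      case True
      then obtain k where k: "k < n" "\<beta> = reflected_exponent q (h k)" by (rule reduced_monomials_cases)
      have "Poly_Mapping.lookup (f * g) \<beta> = (\<Sum>j\<in>{0..<n}. ?M $$ (k, j) * Poly_Mapping.lookup g (h j))"
        unfolding k(2) by (rule lookup_mult_reflected[OF f keys k(1)])
      also have "\<dots> = (\<Sum>j\<in>{0..<n}. ?M $$ (k, j) * adj_mat ?M $$ (j, i))"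
        by (intro sum.cong refl) (simp add: g_def lookup_sum_enum)
      also have "\<dots> = (?M * adj_mat ?M) $$ (k, i)"
        using k i M adj_mat(1)[OF M] by (simp add: scalar_prod_def)
      also have "\<dots> = (if k = i then det ?M else 0)"
        using k i by (simp add: adj_mat(2)[OF M])
      also have "\<dots> = Poly_Mapping.lookup (Poly_Mapping.single \<alpha> (det ?M)) \<beta>"
      proof -
        have "reflected_exponent q (reflected_exponent q (h j)) = h j" if "j < n" for j
          using enum_reduced_monomials_mem[OF that] by (cases "h j") (auto simp: reduced_monomials_iff)
        then have "\<alpha> = \<beta> \<longleftrightarrow> h i = h k" using i k by metis
        then show ?thesis using i k by (auto simp: lookup_single when_def enum_reduced_monomials_eq_iff)
      qed
      finally show ?thesis by (simp add: lookup_minus)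
    next
      case False
      then have deg: "exponent_degree \<beta> \<noteq> e + 2 * m" using \<beta> by (auto simp: reduced_monomials_def)
      have "Poly_Mapping.lookup (g * f) \<beta> = 0"
      proof -
        obtain a b c where abc: "\<beta> = (a, b, c)" by (cases \<beta>)
        show ?thesis
          unfolding abc lookup_mult_eq_sum
        proof (rule sum.neutral, clarify)
          fix a' b' c' assume "(a', b', c') \<in> Poly_Mapping.keys g"
          then have "(a', b', c') \<in> reduced_monomials q e" using keys by blast
          then have "Poly_Mapping.lookup f (a - a', b - b', c - c') = 0" if "a' \<le> a" "b' \<le> b" "c' \<le> c"
            using that deg abc by (intro lookup_forms_eq_0[OF f]) (auto simp: reduced_monomials_iff)
          then show "(if a' \<le> a \<and> b' \<le> b \<and> c' \<le> c then Poly_Mapping.lookup g (a', b', c') *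
            Poly_Mapping.lookup f (a - a', b - b', c - c') else 0) = 0" by simp
        qed
      qed
      moreover have "\<alpha> \<noteq> \<beta>" using \<alpha> False by auto
      ultimately show ?thesis by (simp add: lookup_minus lookup_single when_def mult.commute)
    qed
  qed
  ultimately have "Poly_Mapping.single \<alpha> (det ?M) \<in> frobenius_ideal f q"
    using frobenius_ideal_add by fastforce
  from frobenius_ideal_mult[OF this, of "Poly_Mapping.single 0 (inverse (det ?M))"]
  show ?thesis using det by (simp add: mult_single)
qed

section \<open>Top degree of the quotient and its regularity\<close>

text \<open>A reduced monomial of degree at least \<open>e + 2m\<close> has a reduced divisor of
  degree exactly \<open>e + 2m\<close>, which lies in the ideal.\<close>

lemma homogeneous_part_subset_frobenius_ideal:
  fixes f :: "'k::field poly3"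
  assumes f: "f \<in> forms (2 * m)" and det: "det (multiplication_matrix q e f) \<noteq> 0"
    and j: "int (e + 2 * m) \<le> j"
  shows "homogeneous_part j \<subseteq> frobenius_ideal f q"
proof
  fix s :: "'k poly3" assume s: "s \<in> homogeneous_part j"
  have "Poly_Mapping.single \<beta> v \<in> frobenius_ideal f q" if \<beta>: "\<beta> \<in> Poly_Mapping.keys s" for \<beta> v
  proof (cases "\<beta> \<in> reduced_exponents q")
    case True
    obtain a b c where abc: "\<beta> = (a, b, c)" by (cases \<beta>)
    let ?D = "e + 2 * m"
    have le: "?D \<le> a + b + c" using s \<beta> j abc by (force simp: homogeneous_part_def)
    define a' b' where "a' = min a ?D" and "b' = min b (?D - a')"
    define c' where "c' = ?D - a' - b'"
    have le': "a' \<le> a" "b' \<le> b" "c' \<le> c" "a' + b' + c' = ?D"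
      using le by (auto simp: a'_def b'_def c'_def)
    then have "(a', b', c') \<in> reduced_monomials q ?D"
      using True abc by (auto simp: reduced_monomials_iff reduced_exponents_def)
    from frobenius_ideal_mult[OF single_mem_frobenius_ideal[OF f det this], of "Poly_Mapping.single (a - a', b - b', c - c') v"]
    show ?thesis using le' by (simp add: abc mult_single plus_prod_def)
  next
    case False
    then show ?thesis by (intro frobenius_idealI_lookup) (auto simp: lookup_single when_def)
  qed
  then have "(\<Sum>\<beta>\<in>Poly_Mapping.keys s. Poly_Mapping.single \<beta> (Poly_Mapping.lookup s \<beta>)) \<in> frobenius_ideal f q"
    by (intro frobenius_ideal_sum)
  then show "s \<in> frobenius_ideal f q" by (simp only: poly_mapping_eq_sum_single)
qed

text \<open>Some reduced monomial of degree \<open>e + 2m\<close> exists and lies in the ideal; for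
  \<open>f = 0\<close> no element of the ideal would involve a reduced monomial.\<close>

lemma nonzero_if_det_nonzero:
  fixes f :: "'k::field poly3"
  assumes "f \<in> forms (2 * m)" "det (multiplication_matrix q e f) \<noteq> 0" "m \<ge> 1" "e \<ge> 1"
  shows "f \<noteq> 0"
proof
  assume "f = 0"
  have "card (reduced_monomials q (e - 1)) < card (reduced_monomials q (Suc (e - 1)))"
    by (rule card_reduced_monomials_less_Suc) (use e assms in auto)
  also have "\<dots> = card (reduced_monomials q (e + 2 * m))"
    by (rule card_reduced_monomials_reflect) (use e assms in auto)
  finally obtain \<alpha> where \<alpha>: "\<alpha> \<in> reduced_monomials q (e + 2 * m)"
    by (metis card.empty equals0I less_nat_zero_code)
  obtain a b c d where eq: "Poly_Mapping.single \<alpha> 1 = f * a + var_x ^ q * b + var_y ^ q * c + var_z ^ q * d"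
    using single_mem_frobenius_ideal[OF assms(1,2) \<alpha>] by (rule frobenius_idealE)
  have "Poly_Mapping.lookup (Poly_Mapping.single \<alpha> (1 :: 'k)) \<alpha> = 0"
    unfolding eq using \<alpha> by (subst lookup_mod_frobenius_ideal) (auto simp: reduced_monomials_def \<open>f = 0\<close>)
  then show False by simp
qed

lemma regularity_frobenius_quotient:
  fixes f :: "'k::field poly3"
  assumes f: "f \<in> forms (2 * m)" and det: "det (multiplication_matrix q e f) \<noteq> 0"
    and "m \<ge> 1" "e \<ge> 1"
  shows "regularity (frobenius_quotient f q) (frobenius_quotient_grading f q) =
    ereal (real_of_int (int (e + 2 * m) - 1))"
proof -
  have zero: "\<zero>\<^bsub>frobenius_quotient f q\<^esub> = quotient_class f q 0"
    using quotient_class_eq_zero_iff[of f q 0] frobenius_ideal_zero by metis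
  have zero_mem: "0 \<in> homogeneous_part j" for j
    by (simp add: homogeneous_part_def)
  have add_mem: "s + t \<in> homogeneous_part j" "s - t \<in> homogeneous_part j"
    if "s \<in> homogeneous_part j" "t \<in> homogeneous_part j" for s t :: "'k poly3" and j
  proof -
    have "k \<in> Poly_Mapping.keys s \<or> k \<in> Poly_Mapping.keys t"
      if "k \<in> Poly_Mapping.keys (s + t) \<or> k \<in> Poly_Mapping.keys (s - t)" for k
      using that by (auto simp: in_keys_iff lookup_add lookup_minus)
    then show "s + t \<in> homogeneous_part j" "s - t \<in> homogeneous_part j"
      using that unfolding homogeneous_part_def by blast+
  qed
  have var_mem: "v * s \<in> homogeneous_part (j + 1)"
    if "s \<in> homogeneous_part j" "v \<in> {var_x, var_y, var_z}" for s v :: "'k poly3" and j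
  proof -
    have "exponent_degree (\<beta> + \<gamma>) = exponent_degree \<beta> + exponent_degree \<gamma>" for \<beta> \<gamma>
      by (cases \<beta>; cases \<gamma>) (simp add: plus_prod_def)
    moreover have "exponent_degree \<beta> = 1" if "\<beta> \<in> Poly_Mapping.keys v" for \<beta>
      using that \<open>v \<in> _\<close> by (auto simp: var_x_def var_y_def var_z_def)
    moreover have "int (exponent_degree \<gamma>) = j" if "\<gamma> \<in> Poly_Mapping.keys s" for \<gamma>
      using that \<open>s \<in> _\<close> by (simp add: homogeneous_part_def)
    ultimately have "int (exponent_degree (\<beta> + \<gamma>)) = j + 1"
      if "\<beta> \<in> Poly_Mapping.keys v" "\<gamma> \<in> Poly_Mapping.keys s" for \<beta> \<gamma>
      using that by simp
    then show ?thesis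
      using keys_mult[of v s] unfolding homogeneous_part_def by blast
  qed
  \<comment> \<open>The counts increase from \<open>e - 1\<close> to \<open>e + 1\<close>, which is
    dual to \<open>e + 2m - 1\<close>; so multiplication by \<open>f\<close> is not onto in degree
    \<open>e + 2m - 1\<close>.\<close>
  have "card (reduced_monomials q (e - 1)) < card (reduced_monomials q (Suc (e - 1)))"
    by (rule card_reduced_monomials_less_Suc) (use e \<open>m \<ge> 1\<close> \<open>e \<ge> 1\<close> in auto)
  also have "\<dots> < card (reduced_monomials q (Suc (Suc (e - 1))))"
    by (rule card_reduced_monomials_less_Suc) (use e \<open>m \<ge> 1\<close> \<open>e \<ge> 1\<close> in auto)
  also have "\<dots> = card (reduced_monomials q (e - 1 + 2 * m))"
    by (rule card_reduced_monomials_reflect) (use e \<open>m \<ge> 1\<close> \<open>e \<ge> 1\<close> in auto)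
  finally obtain \<alpha> where \<alpha>: "\<alpha> \<in> reduced_monomials q (e - 1 + 2 * m)"
    "Poly_Mapping.single \<alpha> 1 \<notin> frobenius_ideal f q"
    using exists_monomial_notin_frobenius_ideal[OF f] by blast
  show ?thesis
  proof (rule regularity_eq_top_degree[where w = "quotient_class f q (Poly_Mapping.single \<alpha> 1)"])
    show "frobenius_quotient_grading f q j = {\<zero>\<^bsub>frobenius_quotient f q\<^esub>}" if "j > int (e + 2 * m) - 1" for j
    proof -
      have "homogeneous_part j \<subseteq> frobenius_ideal f q"
        by (rule homogeneous_part_subset_frobenius_ideal[OF f det]) (use that in simp)
      then have "quotient_class f q s = \<zero>\<^bsub>frobenius_quotient f q\<^esub>" if "s \<in> homogeneous_part j" for s
        using that by (simp add: quotient_class_eq_zero_iff subset_iff)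
      then show ?thesis using zero_mem unfolding frobenius_quotient_grading_def by blast
    qed
    show "quotient_class f q (Poly_Mapping.single \<alpha> 1) \<in> frobenius_quotient_grading f q (int (e + 2 * m) - 1)"
      using \<alpha>(1) \<open>e \<ge> 1\<close> unfolding frobenius_quotient_grading_def
      by (intro imageI) (auto simp: homogeneous_part_def reduced_monomials_def)
    show "quotient_class f q (Poly_Mapping.single \<alpha> 1) \<noteq> \<zero>\<^bsub>frobenius_quotient f q\<^esub>"
      using \<alpha>(2) by (simp add: quotient_class_eq_zero_iff)
  qed (auto simp: frobenius_quotient_grading_def zero zero_mem quotient_class_add quotient_class_diff
      quotient_class_smult intro!: imageI add_mem var_mem)
qed

end

section \<open>Intersection of the open conditions over all powers of \<open>p\<close>\<close>

theorem theoremC: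
  fixes p d :: nat
  assumes "CHAR('k::field) = p" and "p > 0"
    and "odd p" and "even d" and "d \<ge> 2" and "p > d"
  shows "holds_for_very_general_form d (\<lambda>f :: 'k poly3. f \<noteq> 0 \<and>
           (\<forall>e q. e \<ge> 1 \<longrightarrow> q = p ^ e \<longrightarrow>
             regularity (frobenius_quotient f q) (frobenius_quotient_grading f q)
               = ereal (3/2 * real q + 1/2 * real d - 5/2)))"
proof -
  obtain m where d: "d = 2 * m" using \<open>even d\<close> by (rule evenE)
  have m: "m \<ge> 1" using \<open>d \<ge> 2\<close> d by simp
  define E where "E = (\<lambda>k. (3 * p ^ k - 3) div 2 - m)"
  have E: "2 * (E k + m) + 3 = 3 * p ^ k" "E k \<ge> 1" if "k \<ge> 1" for k
  proof -
    \<comment> \<open>Since \<open>p^k\<close> is odd and at least \<open>p > 2m\<close>, the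
      division in \<open>E k\<close> is exact and the subtraction of \<open>m\<close> leaves a
      positive number.\<close>
    have "p \<le> p ^ k" using self_le_power[of p k] that \<open>p > 0\<close> by simp
    moreover have "odd (p ^ k)" using \<open>odd p\<close> by simp
    then obtain t where "p ^ k = 2 * t + 1" by (rule oddE)
    ultimately show "2 * (E k + m) + 3 = 3 * p ^ k" "E k \<ge> 1"
      using \<open>p > d\<close> d m by (auto simp: E_def)
  qed
  define U where "U k = {f \<in> forms d. det (multiplication_matrix (p ^ k) (E k) f) \<noteq> (0 :: 'k)}" for k
  show ?thesis
    unfolding holds_for_very_general_form_def
  proof (intro exI[of _ "U ` {1..}"] conjI ballI)
    show "zariski_open d V" if "V \<in> U ` {1..}" for V
      using that unfolding U_def multiplication_matrix_def
      by (auto intro: zariski_open_det_nonzero)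
    \<comment> \<open>One form, chosen independently of \<open>k\<close>, lies in all the open sets;
      this makes the intersection nonempty.\<close>
    have "conic_power m \<in> U k" if "k \<ge> 1" for k
      using det_conic_power_nonzero[OF E(1)[OF that] \<open>CHAR('k) = p\<close>] that \<open>odd p\<close> \<open>p > d\<close> conic_power_forms[of m]
      by (auto simp: U_def d)
    then show "forms d \<inter> \<Inter> (U ` {1..}) \<noteq> {}"
      using conic_power_forms[of m] by (auto simp: d)
  next
    fix f assume "f \<in> forms d \<inter> \<Inter> (U ` {1..})"
    then have f: "f \<in> forms (2 * m)" and det: "\<And>k. k \<ge> 1 \<Longrightarrow> det (multiplication_matrix (p ^ k) (E k) f) \<noteq> 0"
      by (auto simp: U_def d)
    show "f \<noteq> 0"
      using nonzero_if_det_nonzero[OF E(1) f det m E(2), of 1] by simp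
    show "\<forall>e q. e \<ge> 1 \<longrightarrow> q = p ^ e \<longrightarrow>
             regularity (frobenius_quotient f q) (frobenius_quotient_grading f q)
               = ereal (3/2 * real q + 1/2 * real d - 5/2)"
    proof (intro allI impI)
      fix k q assume k: "k \<ge> 1" and q: "q = p ^ k"
      \<comment> \<open>The top degree is \<open>E k + 2m - 1 = (3q - 3)/2 + m - 1\<close>.\<close>
      have "2 * (real (E k) + real m) + 3 = 3 * real q"
        using arg_cong[OF E(1)[OF k], of real] by (simp add: q)
      then have "real_of_int (int (E k + 2 * m) - 1) = 3/2 * real q + 1/2 * real d - 5/2"
        by (simp add: d)
      then show "regularity (frobenius_quotient f q) (frobenius_quotient_grading f q)
               = ereal (3/2 * real q + 1/2 * real d - 5/2)"
        using regularity_frobenius_quotient[OF E(1)[OF k] f det[OF k] m E(2)[OF k]] by (simp only: q)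
    qed
  qed auto
qed

end
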